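(* For every integer $k \geq 3$, there are constants $c=c(k)$ and $\delta=\delta(k)>0$ such that any arrangement of $n$ points and $n$ lines in the plane that does not contain a subconfiguration isomorphic to a subdivided $k$-clique determines at most $c\, n^{5/4-\delta}$ incidences.
   Context: For a finite set $P$ of points and a finite set $\mathcal{L}$ of lines in $\mathbb{R}^2$, an incidence is a pair $(p,L)\in P\times\mathcal{L}$ with $p\in L$. The incidence graph $G(P,\mathcal{L})$ is the (oriented) bipartite graph with vertex set $P\cup\mathcal{L}$ whose edges are the incidences, oriented from points to lines. Two configurations are isomorphic if their incidence graphs are isomorphic (points corresponding to points and lines to lines). A subconfiguration of $(P,\mathcal{L})$ is a pair $(P_1,\mathcal{L}_1)$ with $P_1\subseteq P$ and $\mathcal{L}_1\subseteq\mathcal{L}$. Subdivided $k$-clique ($k\ge 3$): a configuration $(P_0,\mathcal{L}_0)$ where $P_0$ is a set of $k+\binom{k}{2}$ points, $k$ of them called black and the other $\binom{k}{2}$ called white, and $\mathcal{L}_0$ is a set of $2\binom{k}{2}$ lines in the plane, such that: for any two black points there are two lines from $\mathcal{L}_0$, each containing one of the two black points, that intersect in a white point; each white point lies on exactly two lines from $\mathcal{L}_0$; and each line from $\mathcal{L}_0$ contains exactly one black and exactly one white point. That is, the graph on $P_0$ in which two points are adjacent if and only if they lie on a common line of $\mathcal{L}_0$ is the 1-subdivision of $K_k$ (each edge of $K_k$ replaced by a path of length two through a new white vertex). *)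

theory Defs
  imports "HOL-Analysis.Analysis"
begin

type_synonym point = "real ^ 2"
type_synonym line = "point set"

definition is_line :: "line \<Rightarrow> bool" where
  "is_line L \<longleftrightarrow> affine L \<and> aff_dim L = 1"

definition configuration :: "point set \<Rightarrow> line set \<Rightarrow> bool" where
  "configuration P \<L> \<longleftrightarrow> finite P \<and> finite \<L> \<and> (\<forall>L\<in>\<L>. is_line L)"

text \<open>The edge set of the incidence graph; a pair is oriented from its point to its line.\<close>

definition incidences :: "point set \<Rightarrow> line set \<Rightarrow> (point \<times> line) set" where
  "incidences P \<L> = {(p, L) \<in> P \<times> \<L>. p \<in> L}"

definition isomorphic_configurations ::
    "point set \<Rightarrow> line set \<Rightarrow> point set \<Rightarrow> line set \<Rightarrow> bool" where
  "isomorphic_configurations P \<L> P' \<L>' \<longleftrightarrow>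
     (\<exists>f g. bij_betw f P P' \<and> bij_betw g \<L> \<L>' \<and>
       (\<forall>p\<in>P. \<forall>L\<in>\<L>. (p, L) \<in> incidences P \<L> \<longleftrightarrow> (f p, g L) \<in> incidences P' \<L>'))"

text \<open>
  \<open>B\<close> and \<open>W\<close> are the black and the white points. Since a white point lies on exactly two lines
  and each line carries one black point, a white point serves at most one pair of black points, so
  the white points correspond bijectively to the pairs of black points.
\<close>

definition subdivided_clique :: "nat \<Rightarrow> point set \<Rightarrow> line set \<Rightarrow> bool" where
  "subdivided_clique k P \<L> \<longleftrightarrow>
     configuration P \<L> \<and> card \<L> = 2 * (k choose 2) \<and>
     (\<exists>B W. P = B \<union> W \<and> B \<inter> W = {} \<and> card B = k \<and> card W = k choose 2 \<and>
       (\<forall>b\<in>B. \<forall>b'\<in>B. b \<noteq> b' \<longrightarrow>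
         (\<exists>L\<in>\<L>. \<exists>L'\<in>\<L>. L \<noteq> L' \<and> b \<in> L \<and> b' \<in> L' \<and> (\<exists>w\<in>W. w \<in> L \<inter> L'))) \<and>
       (\<forall>w\<in>W. card {L\<in>\<L>. w \<in> L} = 2) \<and>
       (\<forall>L\<in>\<L>. card (L \<inter> B) = 1 \<and> card (L \<inter> W) = 1))"

definition contains_subdivided_clique :: "nat \<Rightarrow> point set \<Rightarrow> line set \<Rightarrow> bool" where
  "contains_subdivided_clique k P \<L> \<longleftrightarrow>
     (\<exists>P\<^sub>1 \<L>\<^sub>1 P\<^sub>0 \<L>\<^sub>0. P\<^sub>1 \<subseteq> P \<and> \<L>\<^sub>1 \<subseteq> \<L> \<and> subdivided_clique k P\<^sub>0 \<L>\<^sub>0 \<and>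
       isomorphic_configurations P\<^sub>1 \<L>\<^sub>1 P\<^sub>0 \<L>\<^sub>0)"

end

theory Submission
  imports Defs "HOL-Real_Asymp.Real_Asymp"
begin

text \<open>Of the plane the argument uses only that two points lie on at most one common line. In the
incidence graph a subdivided \<open>k\<close>-clique is an induced subdivision of the complete graph in which
each edge is a path \<open>x - L - q - L' - y\<close> between two points \<open>x\<close> and \<open>y\<close>. If every point lies on about
\<open>d\<close> of the lines and every line contains about \<open>d\<close> of the points, there are about \<open>n * d ^ 4\<close> such
paths, and \<open>n powr (5 / 4)\<close> incidences is the threshold at which this number reaches \<open>n\<^sup>2\<close>, the number
of pairs of end points.

A pair of points is called heavy if \<open>m\<close> such paths, with pairwise different first lines and pairwise
different last lines, connect it; here \<open>m\<close> depends on \<open>k\<close> alone. Suppose first that some \<open>k\<close> points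
are pairwise heavy. Choosing one of the \<open>m\<close> paths for each pair at random produces an induced
subdivision with positive probability, because a point of one chosen path lies on at most two of the
candidate lines of another pair (\<open>heavy_clique_gives_subdivision\<close>).

Suppose now that no \<open>k\<close> points are pairwise heavy. By Turan's theorem a positive proportion of the
pairs on each line is light, that is, not heavy, and the same holds for the pairs of points at
distance two from a given point. This yields a positive proportion of all paths \<open>x - L - q - L' - y\<close>
such that \<open>q x\<close>, \<open>q y\<close> and \<open>x y\<close> are light. The links of a light pair are covered by fewer than \<open>m\<close>
first and fewer than \<open>m\<close> last lines. Applied to \<open>q y\<close> and \<open>q x\<close>, the cover shows that hardly any of
these paths has a first line from which \<open>y\<close> is reached in more than \<open>m\<close> ways, or a last line of that
kind for \<open>x\<close>; applied to \<open>x y\<close>, it shows that the other paths run at most \<open>2 * m\<^sup>2\<close> to a pair. So the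
number of pairs joined by a path is, up to a constant, the number of paths, and some point is joined
to a large share of all points. This holds inside every large set \<open>X\<close> of points
(\<open>point_joined_to_many\<close>).

Hence the branch points can be selected one after the other, each time passing to the subset of
points joined to the new one. The union of the connecting paths is induced if the new branch point
is not collinear with certain dangerous points. This excludes fewer points than are available, by a
factor of about \<open>d\<close> (\<open>induced_subdivision_extend\<close>, \<open>card_danger\<close>). The one coincidence which this does not exclude is
that two paths enter the new point through the same line. It is prevented by colouring the incidences
at each point with \<open>k\<close> colours beforehand and using only colour \<open>i\<close> for the paths from the \<open>i\<close>-th
branch point (\<open>dense_regular_gives_subdivision\<close>).

Each selection costs a factor that is a small power of \<open>n\<close>, and there are \<open>k\<close> selections. With
\<open>T = n powr \<delta>\<close> for a small \<open>\<delta>\<close>, all constants and the logarithmic factors lost by making the degrees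
regular (\<open>regular_subsystem\<close>) are below \<open>T\<close>, so that everything reduces to comparing powers of \<open>T\<close>
with \<open>n powr (1 / 4)\<close> (\<open>many_incidences_give_subdivision\<close>).\<close>

section \<open>Matchings, random selections and cliques\<close>

lemma card_le_1_if_all_equal:
  assumes "\<And>a b. a \<in> S \<Longrightarrow> b \<in> S \<Longrightarrow> a = b"
  shows "card S \<le> 1"
  using assms by (cases "finite S") (auto simp: card_le_Suc0_iff_eq)

text \<open>A weak form of Koenig's theorem, which suffices because only the boundedness of the cover matters:
the end points of a maximal matching cover all edges.\<close>

lemma matching_or_cover:
  fixes R :: "('a \<times> 'b) set"
  assumes "finite R" and "\<not> (\<exists>S\<subseteq>R. card S = m \<and> inj_on fst S \<and> inj_on snd S)"
  obtains A B where "A \<subseteq> fst ` R" "B \<subseteq> snd ` R" "card A < m" "card B < m"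
    "\<forall>(a, b)\<in>R. a \<in> A \<or> b \<in> B"
proof -
  have "\<exists>A B. A \<subseteq> fst ` R \<and> B \<subseteq> snd ` R \<and> card A < m \<and> card B < m \<and>
    (\<forall>(a, b) \<in> R. a \<in> A \<or> b \<in> B)"
    using assms(2)
  proof (induction m)
    case 0
    then show ?case by (metis card.empty empty_subsetI inj_on_empty)
  next
    case (Suc m)
    show ?case
    proof (cases "\<exists>S\<subseteq>R. card S = m \<and> inj_on fst S \<and> inj_on snd S")
      case False
      with Suc.IH show ?thesis using less_Suc_eq by blast
    next
      case True
      then obtain S where S: "S \<subseteq> R" "card S = m" "inj_on fst S" "inj_on snd S" by blast
      have fS: "finite S" using S(1) assms(1) finite_subset by blast
      have "a \<in> fst ` S \<or> b \<in> snd ` S" if "(a, b) \<in> R" for a b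
      proof (rule ccontr)
        assume n: "\<not> ?thesis"
        have "(a, b) \<notin> S" using n by force
        moreover have "inj_on fst (insert (a, b) S)" "inj_on snd (insert (a, b) S)"
          using S n by (auto simp: inj_on_insert)
        ultimately have "insert (a, b) S \<subseteq> R \<and> card (insert (a, b) S) = Suc m \<and>
            inj_on fst (insert (a, b) S) \<and> inj_on snd (insert (a, b) S)"
          using that S fS by auto
        with Suc.prems show False by blast
      qed
      moreover have "card (fst ` S) < Suc m" "card (snd ` S) < Suc m"
        using S by (auto simp: card_image)
      ultimately show ?thesis
        using S(1) by (intro exI[of _ "fst ` S"] exI[of _ "snd ` S"]) auto
    qed
  qed
  then show ?thesis using that by blast
qed

text \<open>The union bound for independent uniform choices: a fixed pair of indices is in conflict with
probability at most \<open>c / m\<close>, and there are at most \<open>(card I)\<^sup>2\<close> pairs.\<close>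

lemma selection_without_conflict:
  fixes conflict :: "'i \<Rightarrow> 'c \<Rightarrow> 'i \<Rightarrow> 'c \<Rightarrow> bool"
  assumes "finite I" and T: "\<And>i. i \<in> I \<Longrightarrow> card (T i) = m"
    and few: "\<And>i j t. i \<in> I \<Longrightarrow> j \<in> I \<Longrightarrow> i \<noteq> j \<Longrightarrow> t \<in> T i \<Longrightarrow>
               card {s \<in> T j. conflict i t j s} \<le> c"
    and big: "c * (card I)\<^sup>2 < m"
  obtains f where "\<And>i. i \<in> I \<Longrightarrow> f i \<in> T i"
    "\<And>i j. i \<in> I \<Longrightarrow> j \<in> I \<Longrightarrow> i \<noteq> j \<Longrightarrow> \<not> conflict i (f i) j (f j)"
proof -
  define \<F> where "\<F> = PiE I T"
  define bad where "bad i j = {f \<in> \<F>. i \<noteq> j \<and> conflict i (f i) j (f j)}" for i j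
  have finT: "finite (T i)" if "i \<in> I" for i
    using T[OF that] big by (metis card.infinite not_less_zero)
  have cardF: "card \<F> = m ^ card I"
    unfolding \<F>_def using assms(1) T by (simp add: card_PiE)
  have cardbad: "card (bad i j) \<le> c * m ^ (card I - 1)" if "i \<in> I" "j \<in> I" for i j
  proof (cases "i = j")
    case False
    let ?G = "PiE (I - {j}) T"
    \<comment> \<open>A bad choice is a choice away from \<open>j\<close> plus one of at most \<open>c\<close> conflicting entries at \<open>j\<close>.\<close>
    have "bad i j \<subseteq> (\<Union>g\<in>?G. (\<lambda>s. g(j := s)) ` {s \<in> T j. conflict i (g i) j s})"
    proof
      fix f assume f: "f \<in> bad i j"
      have "f(j := undefined) \<in> ?G"
        using f that by (auto simp: bad_def \<F>_def PiE_def Pi_def extensional_def)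
      moreover have "f \<in> (\<lambda>s. (f(j := undefined))(j := s)) `
            {s \<in> T j. conflict i ((f(j := undefined)) i) j s}"
        using f that False by (intro image_eqI[of _ _ "f j"]) (auto simp: bad_def \<F>_def)
      ultimately show "f \<in> (\<Union>g\<in>?G. (\<lambda>s. g(j := s)) ` {s \<in> T j. conflict i (g i) j s})"
        by blast
    qed
    moreover have finG: "finite ?G" using assms(1) finT by (intro finite_PiE) auto
    moreover have "finite (\<Union>g\<in>?G. (\<lambda>s. g(j := s)) ` {s \<in> T j. conflict i (g i) j s})"
      using finG finT that by auto
    ultimately have "card (bad i j) \<le> card (\<Union>g\<in>?G. (\<lambda>s. g(j := s)) ` {s \<in> T j. conflict i (g i) j s})"
      by (intro card_mono)
    also have "\<dots> \<le> (\<Sum>g\<in>?G. card ((\<lambda>s. g(j := s)) ` {s \<in> T j. conflict i (g i) j s}))"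
      by (rule card_UN_le[OF finG])
    also have "\<dots> \<le> (\<Sum>g\<in>?G. c)"
    proof (rule sum_mono)
      fix g assume g: "g \<in> ?G"
      have "g i \<in> T i" using g that False by auto
      then show "card ((\<lambda>s. g(j := s)) ` {s \<in> T j. conflict i (g i) j s}) \<le> c"
        using few[OF that False \<open>g i \<in> T i\<close>] finT[OF that(2)]
        by (intro order_trans[OF card_image_le]) auto
    qed
    also have "\<dots> = c * m ^ (card I - 1)"
    proof -
      have "(\<Prod>i\<in>I - {j}. card (T i)) = (\<Prod>i\<in>I - {j}. m)" using T by (intro prod.cong) auto
      then show ?thesis using assms(1) that by (simp add: card_PiE)
    qed
    finally show ?thesis .
  qed (simp add: bad_def)
  have "\<exists>f\<in>\<F>. f \<notin> (\<Union>(i, j) \<in> I \<times> I. bad i j)"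
  proof (rule ccontr)
    assume "\<not> ?thesis"
    then have sub: "\<F> \<subseteq> (\<Union>(i, j) \<in> I \<times> I. bad i j)" by blast
    have finF: "finite \<F>" unfolding \<F>_def using assms(1) finT by (intro finite_PiE) auto
    have "finite (\<Union>(i, j) \<in> I \<times> I. bad i j)"
      using assms(1) finF by (auto simp: bad_def)
    then have "card \<F> \<le> card (\<Union>(i, j) \<in> I \<times> I. bad i j)" using sub by (intro card_mono)
    also have "\<dots> \<le> (\<Sum>p\<in>I \<times> I. card (case p of (i, j) \<Rightarrow> bad i j))"
      using assms(1) by (intro card_UN_le) auto
    also have "\<dots> \<le> (\<Sum>p\<in>I \<times> I. c * m ^ (card I - 1))"
      using cardbad by (intro sum_mono) auto
    also have "\<dots> = c * (card I)\<^sup>2 * m ^ (card I - 1)"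
      by (simp add: card_cartesian_product power2_eq_square)
    finally have le: "m ^ card I \<le> c * (card I)\<^sup>2 * m ^ (card I - 1)" using cardF by simp
    have mpos: "m > 0" using big by simp
    show False
    proof (cases "card I = 0")
      case True
      then show ?thesis using le by simp
    next
      case False
      then have "m ^ card I = m * m ^ (card I - 1)" by (cases "card I") auto
      then have "m \<le> c * (card I)\<^sup>2" using le mpos by (metis mult_le_cancel2 zero_less_power)
      then show ?thesis using big by linarith
    qed
  qed
  then obtain f where "f \<in> \<F>" "\<And>i j. i \<in> I \<Longrightarrow> j \<in> I \<Longrightarrow> f \<notin> bad i j" by blast
  then show ?thesis by (intro that[of f]) (auto simp: \<F>_def bad_def)
qed

text \<open>Turan's theorem in the form of a count of ordered non-adjacent pairs, the diagonal included. In the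
neighbourhood \<open>N v\<close> of a vertex \<open>v\<close> of maximal degree \<open>d\<close> already the cliques with one vertex less are
excluded, so induction applies to it, and each of the \<open>card A - d\<close> vertices outside \<open>N v\<close> has at least
\<open>card A - d\<close> non-neighbours; the two contributions are combined by the Cauchy-Schwarz inequality.\<close>

lemma many_nonadjacent_pairs_if_no_clique:
  fixes H :: "'a \<Rightarrow> 'a \<Rightarrow> bool"
  assumes "finite A" and sym: "\<And>a b. H a b \<Longrightarrow> H b a" and irr: "\<And>a. \<not> H a a"
    and "\<not> (\<exists>S\<subseteq>A. card S = Suc t \<and> (\<forall>a\<in>S. \<forall>b\<in>S. a \<noteq> b \<longrightarrow> H a b))"
  shows "(card A)\<^sup>2 \<le> t * card {(a, b) \<in> A \<times> A. \<not> H a b}"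
  using assms(1,4)
proof (induction t arbitrary: A)
  case 0
  have "A = {}"
  proof (rule ccontr)
    assume "A \<noteq> {}"
    then obtain a where "a \<in> A" by blast
    then have "{a} \<subseteq> A \<and> card {a} = Suc 0 \<and> (\<forall>x\<in>{a}. \<forall>y\<in>{a}. x \<noteq> y \<longrightarrow> H x y)" by auto
    with 0 show False by blast
  qed
  then show ?case by simp
next
  case (Suc t)
  show ?case
  proof (cases "A = {}")
    case False
    define N where "N v = {b \<in> A. H v b}" for v
    have finN: "finite (N v)" for v using Suc.prems(1) by (simp add: N_def)
    obtain v where v: "v \<in> A" "\<And>u. u \<in> A \<Longrightarrow> card (N u) \<le> card (N v)"
    proof -
      have "Max ((\<lambda>u. card (N u)) ` A) \<in> (\<lambda>u. card (N u)) ` A"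
        using False Suc.prems(1) by (intro Max_in) auto
      then obtain v where "v \<in> A" "Max ((\<lambda>u. card (N u)) ` A) = card (N v)" by auto
      then show ?thesis using that[of v] Suc.prems(1) by (metis Max_ge finite_imageI imageI)
    qed
    let ?d = "card (N v)" and ?r = "card A"
    define n where "n B = card {(a, b) \<in> B \<times> B. \<not> H a b}" for B
    have "\<not> (\<exists>S\<subseteq>N v. card S = Suc t \<and> (\<forall>a\<in>S. \<forall>b\<in>S. a \<noteq> b \<longrightarrow> H a b))"
    proof
      assume "\<exists>S\<subseteq>N v. card S = Suc t \<and> (\<forall>a\<in>S. \<forall>b\<in>S. a \<noteq> b \<longrightarrow> H a b)"
      then obtain S where S: "S \<subseteq> N v" "card S = Suc t" "\<forall>a\<in>S. \<forall>b\<in>S. a \<noteq> b \<longrightarrow> H a b" by blast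
      have "v \<notin> S" using S irr by (auto simp: N_def)
      then have "card (insert v S) = Suc (Suc t)" using S finN finite_subset by fastforce
      moreover have "insert v S \<subseteq> A" using S v by (auto simp: N_def)
      moreover have "\<forall>a\<in>insert v S. \<forall>b\<in>insert v S. a \<noteq> b \<longrightarrow> H a b"
        using S sym by (auto simp: N_def)
      ultimately show False using Suc.prems(2) by blast
    qed
    then have IH: "?d\<^sup>2 \<le> t * n (N v)"
      using Suc.IH[OF finN, of v] by (simp add: n_def)
    have dr: "?d \<le> ?r" using Suc.prems(1) by (auto simp: N_def intro: card_mono)
    \<comment> \<open>Every vertex outside \<open>N v\<close> misses at least as many vertices as \<open>v\<close> does.\<close>
    have "(?r - ?d) * (?r - ?d) \<le> (\<Sum>u\<in>A - N v. card (A - N u))"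
    proof -
      have "(\<Sum>u\<in>A - N v. ?r - ?d) \<le> (\<Sum>u\<in>A - N v. card (A - N u))"
      proof (rule sum_mono)
        fix u assume "u \<in> A - N v"
        then show "?r - ?d \<le> card (A - N u)"
          using v(2)[of u] finN by (subst card_Diff_subset) (auto simp: N_def)
      qed
      moreover have "card (A - N v) = ?r - ?d"
        using finN by (subst card_Diff_subset) (auto simp: N_def)
      ultimately show ?thesis by simp
    qed
    also have "\<dots> = card (Sigma (A - N v) (\<lambda>u. A - N u))"
      using Suc.prems(1) by (simp add: card_SigmaI)
    finally have "(?r - ?d) * (?r - ?d) + n (N v)
        \<le> card (Sigma (A - N v) (\<lambda>u. A - N u)) + card {(a, b) \<in> N v \<times> N v. \<not> H a b}"
      by (simp add: n_def)
    also have "\<dots> = card (Sigma (A - N v) (\<lambda>u. A - N u) \<union> {(a, b) \<in> N v \<times> N v. \<not> H a b})"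
      using Suc.prems(1) finN
      by (intro card_Un_disjoint[symmetric]) (auto intro: finite_subset[OF _ finite_cartesian_product[OF finN finN]])
    also have "\<dots> \<le> n A"
      unfolding n_def using Suc.prems(1)
      by (intro card_mono) (auto simp: N_def intro: finite_subset[of _ "A \<times> A"])
    finally have main: "(?r - ?d)\<^sup>2 + n (N v) \<le> n A" by (simp add: power2_eq_square)
    obtain s where s: "?r = ?d + s" using dr le_iff_add by blast
    have "(?d + s)\<^sup>2 \<le> Suc t * (s\<^sup>2 + n (N v))"
    proof (cases "t = 0")
      case True
      then show ?thesis using IH by simp
    next
      case False
      \<comment> \<open>Cauchy-Schwarz: \<open>(d + s)\<^sup>2 \<le> (1 + t) * (s\<^sup>2 + d\<^sup>2 / t)\<close>, multiplied by \<open>t\<close>.\<close>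
      have "int t * (int ?d + int s)\<^sup>2 \<le> int t * ((1 + int t) * (int s)\<^sup>2) + (1 + int t) * (int ?d)\<^sup>2"
        using zero_le_power2[of "int t * int s - int ?d"] by (simp add: power2_eq_square algebra_simps)
      also have "\<dots> \<le> int t * ((1 + int t) * (int s)\<^sup>2) + (1 + int t) * (int t * int (n (N v)))"
        using IH by (intro add_left_mono mult_left_mono) (simp_all flip: of_nat_mult of_nat_power)
      also have "\<dots> = int t * ((1 + int t) * ((int s)\<^sup>2 + int (n (N v))))"
        by (simp add: algebra_simps)
      finally have "(int ?d + int s)\<^sup>2 \<le> (1 + int t) * ((int s)\<^sup>2 + int (n (N v)))"
        using False by (simp add: mult_le_cancel_left)
      then have "int ((?d + s)\<^sup>2) \<le> int (Suc t * (s\<^sup>2 + n (N v)))" by (simp add: algebra_simps)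
      then show ?thesis by (simp only: of_nat_le_iff)
    qed
    also have "\<dots> \<le> Suc t * n A" using main s by (intro mult_left_mono) auto
    finally show ?thesis using s by (simp add: n_def)
  qed simp
qed

lemma exists_balanced_colouring:
  assumes "finite A" "k * d \<le> card A"
  shows "\<exists>f :: 'a \<Rightarrow> nat. \<forall>i<k. d \<le> card {a \<in> A. f a = i}"
proof -
  obtain g where g: "bij_betw g A {0..<card A}" using ex_bij_betw_finite_nat[OF assms(1)] by blast
  have "d \<le> card {a \<in> A. g a div d = i}" if "i < k" for i
  proof (cases "d = 0")
    case False
    have "Suc i * d \<le> k * d" using that by (intro mult_right_mono) auto
    then have "i * d + d \<le> card A" using assms(2) by simp
    then have "{i * d..<i * d + d} \<subseteq> g ` {a \<in> A. g a div d = i}"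
    proof (intro subsetI)
      fix j assume j: "j \<in> {i * d..<i * d + d}"
      then have "j \<in> g ` A" using g \<open>i * d + d \<le> card A\<close> by (auto simp: bij_betw_def)
      moreover have "j div d = i" using j by (intro div_nat_eqI) (auto simp: mult.commute)
      ultimately show "j \<in> g ` {a \<in> A. g a div d = i}" by auto
    qed
    then have "card {i * d..<i * d + d} \<le> card (g ` {a \<in> A. g a div d = i})"
      using assms(1) by (intro card_mono) auto
    also have "\<dots> \<le> card {a \<in> A. g a div d = i}" using assms(1) by (intro card_image_le) auto
    finally show ?thesis by simp
  qed simp
  then show ?thesis by (intro exI[of _ "\<lambda>a. g a div d"]) auto
qed

section \<open>Heavy and light pairs of points\<close>

text \<open>The branch points are \<open>x i\<close>, and the edge between \<open>x i\<close> and \<open>x j\<close> becomes the path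
\<open>x i - M i j - w i j - M j i - x j\<close>. The equivalences say that there are no other incidences; they
also force all the points and lines involved to be distinct.\<close>

definition induced_subdivision ::
    "'a set \<Rightarrow> 'a set set \<Rightarrow> nat \<Rightarrow> (nat \<Rightarrow> 'a) \<Rightarrow> (nat \<Rightarrow> nat \<Rightarrow> 'a set) \<Rightarrow> (nat \<Rightarrow> nat \<Rightarrow> 'a) \<Rightarrow> bool" where
  "induced_subdivision P \<L> k x M w \<longleftrightarrow>
     (\<forall>i<k. x i \<in> P) \<and>
     (\<forall>i<k. \<forall>j<k. i \<noteq> j \<longrightarrow> M i j \<in> \<L> \<and> w i j \<in> P \<and> w i j = w j i \<and>
        (\<forall>l<k. x l \<in> M i j \<longleftrightarrow> l = i) \<and>
        (\<forall>a<k. \<forall>b<k. a \<noteq> b \<longrightarrow> (w a b \<in> M i j \<longleftrightarrow> {a, b} = {i, j})))"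

locale linear_space =
  fixes P :: "'a set" and \<L> :: "'a set set"
  assumes finite_points: "finite P" and finite_lines: "finite \<L>"
    and unique_line: "\<And>p q L L'. p \<in> P \<Longrightarrow> q \<in> P \<Longrightarrow> p \<noteq> q \<Longrightarrow> L \<in> \<L> \<Longrightarrow> L' \<in> \<L> \<Longrightarrow>
      p \<in> L \<Longrightarrow> q \<in> L \<Longrightarrow> p \<in> L' \<Longrightarrow> q \<in> L' \<Longrightarrow> L = L'"
begin

text \<open>The pairs of lines that can be the first and the last line of a path \<open>x - L - q - L' - y\<close>. The line
through \<open>x\<close> and \<open>y\<close> is excluded, since the path has to be induced.\<close>

definition links :: "'a \<Rightarrow> 'a \<Rightarrow> ('a set \<times> 'a set) set" where
  "links x y = {(L, L'). L \<in> \<L> \<and> L' \<in> \<L> \<and> x \<in> L \<and> y \<in> L' \<and> y \<notin> L \<and> x \<notin> L' \<and>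
     (\<exists>q\<in>P. q \<in> L \<and> q \<in> L')}"

definition heavy :: "nat \<Rightarrow> 'a \<Rightarrow> 'a \<Rightarrow> bool" where
  "heavy m x y \<longleftrightarrow> (\<exists>S\<subseteq>links x y. card S = m \<and> inj_on fst S \<and> inj_on snd S)"

text \<open>For \<open>y\<close> outside \<open>L\<close> these lines correspond to the paths of length three from \<open>L\<close> to \<open>y\<close>.\<close>

definition lines_meeting :: "'a set \<Rightarrow> 'a \<Rightarrow> 'a set set" where
  "lines_meeting L y = {L' \<in> \<L>. y \<in> L' \<and> (\<exists>q\<in>P. q \<in> L \<and> q \<in> L')}"

lemma finite_links [simp]: "finite (links x y)"
  by (rule finite_subset[of _ "\<L> \<times> \<L>"]) (auto simp: links_def finite_lines)

lemma linksD:
  "e \<in> links x y \<Longrightarrow> fst e \<in> \<L> \<and> snd e \<in> \<L> \<and> x \<in> fst e \<and> y \<in> snd e \<and> y \<notin> fst e \<and> x \<notin> snd e"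
  by (auto simp: links_def)

lemma finite_lines_meeting [simp]: "finite (lines_meeting L y)"
  using finite_lines by (auto simp: lines_meeting_def)

lemma heavy_sym: "heavy m x y \<Longrightarrow> heavy m y x"
proof -
  assume "heavy m x y"
  then obtain S where S: "S \<subseteq> links x y" "card S = m" "inj_on fst S" "inj_on snd S"
    unfolding heavy_def by blast
  have "card (prod.swap ` S) = m" using S by (simp add: card_image)
  moreover have "prod.swap ` S \<subseteq> links y x" using S(1) by (auto simp: links_def)
  moreover have "inj_on fst (prod.swap ` S)" "inj_on snd (prod.swap ` S)"
    using S(3,4) by (auto simp: inj_on_def)
  ultimately show ?thesis unfolding heavy_def by blast
qed

lemma not_heavy_self: "0 < m \<Longrightarrow> \<not> heavy m x x"
proof -
  have "links x x = {}" by (auto simp: links_def)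
  then show "0 < m \<Longrightarrow> \<not> heavy m x x" by (auto simp: heavy_def)
qed

lemma light_cover:
  assumes "\<not> heavy m x y"
  obtains A B where "A \<subseteq> {L \<in> \<L>. x \<in> L \<and> y \<notin> L}" "B \<subseteq> {L \<in> \<L>. y \<in> L \<and> x \<notin> L}"
    "card A < m" "card B < m" "\<forall>(L, L')\<in>links x y. L \<in> A \<or> L' \<in> B"
proof -
  obtain A B where "A \<subseteq> fst ` links x y" "B \<subseteq> snd ` links x y" "card A < m" "card B < m"
    "\<forall>(L, L')\<in>links x y. L \<in> A \<or> L' \<in> B"
    using matching_or_cover[OF finite_links assms[unfolded heavy_def]] by blast
  then show ?thesis by (intro that[of A B]) (auto simp: links_def)
qed

lemma card_meets_light:
  assumes "\<not> heavy m x y" and D: "\<And>L. L \<in> \<L> \<Longrightarrow> card (L \<inter> P) \<le> \<Delta>"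
  shows "card {q \<in> P. \<exists>(L, L') \<in> links x y. q \<in> L \<and> q \<in> L'} \<le> 2 * m * \<Delta>"
proof -
  obtain A B where AB: "A \<subseteq> {L \<in> \<L>. x \<in> L \<and> y \<notin> L}" "B \<subseteq> {L \<in> \<L>. y \<in> L \<and> x \<notin> L}"
    "card A < m" "card B < m" "\<forall>(L, L')\<in>links x y. L \<in> A \<or> L' \<in> B"
    using light_cover[OF assms(1)] by blast
  have fin: "finite (A \<union> B)" using AB(1,2) finite_lines by (auto intro: finite_subset)
  have "card {q \<in> P. \<exists>(L, L') \<in> links x y. q \<in> L \<and> q \<in> L'} \<le> card (\<Union>L\<in>A \<union> B. L \<inter> P)"
    using AB(5) fin finite_points by (intro card_mono) auto
  also have "\<dots> \<le> (\<Sum>L\<in>A \<union> B. card (L \<inter> P))" by (rule card_UN_le[OF fin])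
  also have "\<dots> \<le> (\<Sum>L\<in>A \<union> B. \<Delta>)" using AB(1,2) by (intro sum_mono D) auto
  also have "\<dots> = card (A \<union> B) * \<Delta>" by simp
  also have "\<dots> \<le> 2 * m * \<Delta>"
    using card_Un_le[of A B] AB(3,4) by (intro mult_right_mono) linarith+
  finally show ?thesis .
qed

text \<open>If \<open>L\<close> is outside the cover of the links, then all lines linked with \<open>L\<close> belong to the other half of
the cover, so there are fewer than \<open>m\<close> of them. The line through \<open>q\<close> and \<open>y\<close> may meet \<open>L\<close> as well, but
is not linked with it.\<close>

lemma card_rich_lines_light:
  assumes "\<not> heavy m q y" "q \<in> P" "y \<in> P" "q \<noteq> y"
  shows "card {L \<in> \<L>. q \<in> L \<and> y \<notin> L \<and> m < card (lines_meeting L y)} \<le> m"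
proof -
  obtain A B where AB: "A \<subseteq> {L \<in> \<L>. q \<in> L \<and> y \<notin> L}" "B \<subseteq> {L \<in> \<L>. y \<in> L \<and> q \<notin> L}"
    "card A < m" "card B < m" "\<forall>(L, L')\<in>links q y. L \<in> A \<or> L' \<in> B"
    using light_cover[OF assms(1)] by blast
  have fin: "finite A" "finite B" using AB(1,2) finite_lines by (auto intro: finite_subset)
  have "L \<in> A" if L: "L \<in> \<L>" "q \<in> L" "y \<notin> L" "m < card (lines_meeting L y)" for L
  proof (rule ccontr)
    assume "L \<notin> A"
    have sub: "lines_meeting L y \<subseteq> B \<union> {L' \<in> \<L>. y \<in> L' \<and> q \<in> L'}"
      using AB(5) \<open>L \<notin> A\<close> L by (auto simp: lines_meeting_def links_def)
    have "card {L' \<in> \<L>. y \<in> L' \<and> q \<in> L'} \<le> 1"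
      using unique_line[OF assms(2-4)] by (intro card_le_1_if_all_equal) blast
    then have "card (B \<union> {L' \<in> \<L>. y \<in> L' \<and> q \<in> L'}) \<le> m"
      using card_Un_le[of B "{L' \<in> \<L>. y \<in> L' \<and> q \<in> L'}"] AB(4) by linarith
    moreover have "card (lines_meeting L y) \<le> card (B \<union> {L' \<in> \<L>. y \<in> L' \<and> q \<in> L'})"
      using sub fin finite_lines by (intro card_mono) auto
    ultimately show False using L(4) by linarith
  qed
  then have "card {L \<in> \<L>. q \<in> L \<and> y \<notin> L \<and> m < card (lines_meeting L y)} \<le> card A"
    using fin by (intro card_mono) auto
  then show ?thesis using AB(3) by simp
qed

text \<open>A link with poor ends uses one of fewer than \<open>2 * m\<close> covering lines, and each of these is in at most
\<open>m\<close> links of this kind.\<close>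

lemma card_poor_links_light:
  assumes "\<not> heavy m x y"
  shows "card {(L, L') \<in> links x y. card (lines_meeting L y) \<le> m \<and> card (lines_meeting L' x) \<le> m}
    \<le> 2 * m\<^sup>2"
proof -
  obtain A B where AB: "A \<subseteq> {L \<in> \<L>. x \<in> L \<and> y \<notin> L}" "B \<subseteq> {L \<in> \<L>. y \<in> L \<and> x \<notin> L}"
    "card A < m" "card B < m" "\<forall>(L, L')\<in>links x y. L \<in> A \<or> L' \<in> B"
    using light_cover[OF assms(1)] by blast
  have fin: "finite A" "finite B" using AB(1,2) finite_lines by (auto intro: finite_subset)
  let ?A = "{L \<in> A. card (lines_meeting L y) \<le> m}"
  let ?B = "{L \<in> B. card (lines_meeting L x) \<le> m}"
  let ?S = "{(L, L') \<in> links x y. card (lines_meeting L y) \<le> m \<and> card (lines_meeting L' x) \<le> m}"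
  let ?U = "Sigma ?A (\<lambda>L. lines_meeting L y)" and ?V = "Sigma ?B (\<lambda>L. lines_meeting L x)"
  have "?S \<subseteq> ?U \<union> prod.swap ` ?V"
  proof
    fix p assume "p \<in> ?S"
    then obtain L L' where p: "p = (L, L')" "(L, L') \<in> links x y"
      "card (lines_meeting L y) \<le> m" "card (lines_meeting L' x) \<le> m" by auto
    from AB(5) p(2) have "L \<in> A \<or> L' \<in> B" by blast
    then show "p \<in> ?U \<union> prod.swap ` ?V"
    proof
      assume "L \<in> A"
      then show ?thesis using p by (auto simp: lines_meeting_def links_def)
    next
      assume "L' \<in> B"
      then have "(L', L) \<in> ?V" using p by (auto simp: lines_meeting_def links_def)
      then show ?thesis using p(1) by force
    qed
  qed
  then have "card ?S \<le> card (?U \<union> prod.swap ` ?V)"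
    using fin by (intro card_mono) auto
  also have "\<dots> \<le> card ?U + card ?V"
  proof -
    have "card (prod.swap ` ?V) \<le> card ?V" using fin by (intro card_image_le) auto
    then show ?thesis using card_Un_le[of ?U "prod.swap ` ?V"] by linarith
  qed
  also have "card ?U \<le> card ?A * m"
  proof -
    have "card ?U = (\<Sum>L\<in>?A. card (lines_meeting L y))" using fin by (intro card_SigmaI) auto
    also have "\<dots> \<le> (\<Sum>L\<in>?A. m)" by (intro sum_mono) auto
    finally show ?thesis by simp
  qed
  also have "card ?V \<le> card ?B * m"
  proof -
    have "card ?V = (\<Sum>L\<in>?B. card (lines_meeting L x))" using fin by (intro card_SigmaI) auto
    also have "\<dots> \<le> (\<Sum>L\<in>?B. m)" by (intro sum_mono) auto
    finally show ?thesis by simp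
  qed
  also have "card ?A * m + card ?B * m \<le> m * m + m * m"
  proof -
    have "card ?A \<le> m" "card ?B \<le> m"
      using AB(3,4) card_mono[of A ?A] card_mono[of B ?B] fin by auto
    then show ?thesis by (intro add_mono mult_right_mono) auto
  qed
  finally show ?thesis by (simp add: power2_eq_square)
qed

text \<open>Each pair of branch points comes with a matching of \<open>m\<close> links. The links whose lines pass through
further branch points are discarded. A point of the configuration other than \<open>x i\<close> is on at most
one line through \<open>x i\<close>, hence the middle point of a link of one pair is on the lines of at most two
links of any other pair, and a selection without conflict is an induced subdivision.\<close>

lemma heavy_clique_gives_subdivision:
  assumes S: "S \<subseteq> P" "card S = k" "\<And>a b. a \<in> S \<Longrightarrow> b \<in> S \<Longrightarrow> a \<noteq> b \<Longrightarrow> heavy m a b"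
    and m: "2 * k ^ 4 + 2 * k < m"
  shows "\<exists>x M w. induced_subdivision P \<L> k x M w"
proof -
  obtain x where x: "bij_betw x {0..<k} S"
    using ex_bij_betw_nat_finite[of S] S finite_points finite_subset by metis
  have xS: "x i \<in> S" if "i < k" for i using x that by (auto simp: bij_betw_def)
  have xP: "x i \<in> P" if "i < k" for i using xS[OF that] S by auto
  have xneq: "x i \<noteq> x j" if "i < k" "j < k" "i \<noteq> j" for i j
    using x that by (auto simp: bij_betw_def inj_on_def)
  define I where "I = {(i, j). i < j \<and> j < k}"
  have finI: "finite I" by (rule finite_subset[of _ "{..<k} \<times> {..<k}"]) (auto simp: I_def)
  have cardI: "card I \<le> k\<^sup>2"
  proof -
    have "card I \<le> card ({..<k} \<times> {..<k})" by (intro card_mono) (auto simp: I_def)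
    then show ?thesis by (simp add: power2_eq_square)
  qed
  \<comment> \<open>A matching has at most two links that pass through a given further branch point.\<close>
  define n where "n = m - 2 * k"
  define good where "good i j e \<longleftrightarrow> (\<forall>l<k. (l \<noteq> i \<longrightarrow> x l \<notin> fst e) \<and> (l \<noteq> j \<longrightarrow> x l \<notin> snd e))"
    for i j :: nat and e :: "'a set \<times> 'a set"
  have "\<exists>T. T \<subseteq> {e \<in> links (x i) (x j). good i j e} \<and> card T = n \<and> inj_on fst T \<and> inj_on snd T"
    if "(i, j) \<in> I" for i j
  proof -
    have ij: "i < k" "j < k" "i \<noteq> j" using that by (auto simp: I_def)
    obtain R where R: "R \<subseteq> links (x i) (x j)" "card R = m" "inj_on fst R" "inj_on snd R"
      using S(3)[OF xS xS xneq, OF ij(1,2) ij] unfolding heavy_def by blast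
    have finR: "finite R" using R(1) finite_links finite_subset by blast
    define b1 where "b1 l = {e \<in> R. l \<noteq> i \<and> x l \<in> fst e}" for l
    define b2 where "b2 l = {e \<in> R. l \<noteq> j \<and> x l \<in> snd e}" for l
    have b1: "card (b1 l) \<le> 1" if "l < k" for l
    proof -
      have "e = e'" if "e \<in> b1 l" "e' \<in> b1 l" for e e'
      proof -
        have "fst e = fst e'"
          using unique_line[OF xP[OF ij(1)] xP[OF \<open>l < k\<close>] xneq[OF ij(1) \<open>l < k\<close>], of "fst e" "fst e'"]
            that R(1) linksD[of e "x i" "x j"] linksD[of e' "x i" "x j"] by (auto simp: b1_def)
        then show ?thesis using R(3) that by (auto simp: b1_def inj_on_def)
      qed
      then show ?thesis by (intro card_le_1_if_all_equal) auto
    qed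
    have b2: "card (b2 l) \<le> 1" if "l < k" for l
    proof -
      have "e = e'" if "e \<in> b2 l" "e' \<in> b2 l" for e e'
      proof -
        have "snd e = snd e'"
          using unique_line[OF xP[OF ij(2)] xP[OF \<open>l < k\<close>] xneq[OF ij(2) \<open>l < k\<close>], of "snd e" "snd e'"]
            that R(1) linksD[of e "x i" "x j"] linksD[of e' "x i" "x j"] by (auto simp: b2_def)
        then show ?thesis using R(4) that by (auto simp: b2_def inj_on_def)
      qed
      then show ?thesis by (intro card_le_1_if_all_equal) auto
    qed
    let ?B = "\<Union>l<k. b1 l \<union> b2 l"
    have "card ?B \<le> (\<Sum>l<k. card (b1 l \<union> b2 l))" by (rule card_UN_le) simp
    also have "\<dots> \<le> (\<Sum>l<k. 2)"
    proof (rule sum_mono)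
      fix l assume "l \<in> {..<k}"
      then show "card (b1 l \<union> b2 l) \<le> 2"
        using card_Un_le[of "b1 l" "b2 l"] b1[of l] b2[of l] by simp
    qed
    finally have "card ?B \<le> 2 * k" by simp
    moreover have "card R - card ?B \<le> card (R - ?B)" using finR by (intro diff_card_le_card_Diff) (auto simp: b1_def b2_def)
    ultimately have "n \<le> card (R - ?B)" using R(2) n_def by linarith
    from obtain_subset_with_card_n[OF this] obtain T where T: "T \<subseteq> R - ?B" "card T = n" by blast
    have "good i j e" if "e \<in> T" for e
      using that T(1) by (auto simp: good_def b1_def b2_def)
    moreover have "inj_on fst T" "inj_on snd T"
      using inj_on_subset[OF R(3), of T] inj_on_subset[OF R(4), of T] T(1) by blast+
    ultimately show ?thesis using T R(1) by (intro exI[of _ T]) auto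
  qed
  then have "\<forall>p\<in>I. \<exists>T. T \<subseteq> {e \<in> links (x (fst p)) (x (snd p)). good (fst p) (snd p) e} \<and>
      card T = n \<and> inj_on fst T \<and> inj_on snd T" by auto
  from bchoice[OF this] obtain T where
    T: "\<And>p. p \<in> I \<Longrightarrow> T p \<subseteq> {e \<in> links (x (fst p)) (x (snd p)). good (fst p) (snd p) e}"
    "\<And>p. p \<in> I \<Longrightarrow> card (T p) = n" "\<And>p. p \<in> I \<Longrightarrow> inj_on fst (T p)" "\<And>p. p \<in> I \<Longrightarrow> inj_on snd (T p)"
    by blast
  define meet where "meet e = (SOME q. q \<in> P \<and> q \<in> fst e \<and> q \<in> snd e)" for e :: "'a set \<times> 'a set"
  have meet: "meet e \<in> P" "meet e \<in> fst e" "meet e \<in> snd e" if "e \<in> links a b" for e a b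
  proof -
    have "\<exists>q. q \<in> P \<and> q \<in> fst e \<and> q \<in> snd e" using that by (auto simp: links_def)
    from someI_ex[OF this] show "meet e \<in> P" "meet e \<in> fst e" "meet e \<in> snd e"
      unfolding meet_def by auto
  qed
  define conflict where "conflict (p :: nat \<times> nat) e (p' :: nat \<times> nat) e' \<longleftrightarrow> meet e \<in> fst e' \<or> meet e \<in> snd e'"
    for p e p' and e' :: "'a set \<times> 'a set"
  have meet_neq: "meet e \<noteq> x l" if "p \<in> I" "e \<in> T p" "l < k" for p e l
  proof
    assume eq: "meet e = x l"
    have e: "e \<in> links (x (fst p)) (x (snd p))" "good (fst p) (snd p) e"
      using T(1)[OF that(1)] that(2) by auto
    have "l = fst p" "l = snd p" using e(2) meet(2,3)[OF e(1)] eq that(3) by (auto simp: good_def)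
    then show False using that(1) by (auto simp: I_def)
  qed
  have few: "card {e' \<in> T p'. conflict p e p' e'} \<le> 2"
    if p: "p \<in> I" "p' \<in> I" "e \<in> T p" for p p' e
  proof -
    obtain i j where ij: "p' = (i, j)" "i < k" "j < k" using p(2) by (cases p') (auto simp: I_def)
    have TL: "T p' \<subseteq> links (x i) (x j)" using T(1)[OF p(2)] ij by auto
    have eP: "meet e \<in> P" using meet(1) T(1)[OF p(1)] p(3) by blast
    have 1: "card {e' \<in> T p'. meet e \<in> fst e'} \<le> 1"
    proof -
      have "e1 = e2" if "e1 \<in> T p'" "e2 \<in> T p'" "meet e \<in> fst e1" "meet e \<in> fst e2" for e1 e2
      proof -
        have "fst e1 = fst e2"
          using unique_line[OF eP xP[OF ij(2)] meet_neq[OF p(1,3) ij(2)], of "fst e1" "fst e2"]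
            that TL linksD[of e1 "x i" "x j"] linksD[of e2 "x i" "x j"] by auto
        then show ?thesis using T(3)[OF p(2)] that by (auto simp: inj_on_def)
      qed
      then show ?thesis by (intro card_le_1_if_all_equal) auto
    qed
    have 2: "card {e' \<in> T p'. meet e \<in> snd e'} \<le> 1"
    proof -
      have "e1 = e2" if "e1 \<in> T p'" "e2 \<in> T p'" "meet e \<in> snd e1" "meet e \<in> snd e2" for e1 e2
      proof -
        have "snd e1 = snd e2"
          using unique_line[OF eP xP[OF ij(3)] meet_neq[OF p(1,3) ij(3)], of "snd e1" "snd e2"]
            that TL linksD[of e1 "x i" "x j"] linksD[of e2 "x i" "x j"] by auto
        then show ?thesis using T(4)[OF p(2)] that by (auto simp: inj_on_def)
      qed
      then show ?thesis by (intro card_le_1_if_all_equal) auto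
    qed
    have "{e' \<in> T p'. conflict p e p' e'} = {e' \<in> T p'. meet e \<in> fst e'} \<union> {e' \<in> T p'. meet e \<in> snd e'}"
      by (auto simp: conflict_def)
    then show ?thesis
      using 1 2 card_Un_le[of "{e' \<in> T p'. meet e \<in> fst e'}" "{e' \<in> T p'. meet e \<in> snd e'}"] by simp
  qed
  have "2 * (card I)\<^sup>2 < n"
  proof -
    have "(card I)\<^sup>2 \<le> (k\<^sup>2)\<^sup>2" using cardI by (intro power_mono) auto
    then show ?thesis using m by (simp add: n_def flip: power_mult)
  qed
  then obtain f where f: "\<And>p. p \<in> I \<Longrightarrow> f p \<in> T p"
    "\<And>p p'. p \<in> I \<Longrightarrow> p' \<in> I \<Longrightarrow> p \<noteq> p' \<Longrightarrow> \<not> conflict p (f p) p' (f p')"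
    using selection_without_conflict[where I = I and T = T and m = n and conflict = conflict and c = 2,
      OF finI T(2) few] by blast
  define u where "u i j = (min i j, max i j)" for i j :: nat
  define M where "M i j = (if i < j then fst (f (i, j)) else snd (f (j, i)))" for i j
  define w where "w i j = meet (f (u i j))" for i j
  have uI: "u i j \<in> I" if "i < k" "j < k" "i \<noteq> j" for i j using that by (auto simp: I_def u_def)
  have fl: "f (u i j) \<in> links (x (min i j)) (x (max i j))" "good (min i j) (max i j) (f (u i j))"
    if "i < k" "j < k" "i \<noteq> j" for i j
    using T(1)[OF uI[OF that]] f(1)[OF uI[OF that]] by (auto simp: u_def)
  have Mu: "M i j = fst (f (u i j)) \<and> i = min i j \<or> M i j = snd (f (u i j)) \<and> i = max i j"
    if "i \<noteq> j" for i j using that by (auto simp: M_def u_def)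
  have "induced_subdivision P \<L> k x M w"
    unfolding induced_subdivision_def
  proof (intro conjI allI impI)
    fix i assume "i < k" then show "x i \<in> P" by (rule xP)
  next
    fix i j assume ij: "i < k" "j < k" "i \<noteq> j"
    note fij = fl[OF ij] and Mij = Mu[OF ij(3)]
    show "M i j \<in> \<L>" using Mij fij(1) by (auto simp: links_def)
    show "w i j \<in> P" using meet(1)[OF fij(1)] by (simp add: w_def)
    show "w i j = w j i" by (simp add: w_def u_def min.commute max.commute)
    fix l assume l: "l < k"
    show "x l \<in> M i j \<longleftrightarrow> l = i"
      using Mij fij l by (auto simp: links_def good_def)
  next
    fix i j a b assume ij: "i < k" "j < k" "i \<noteq> j" and ab: "a < k" "b < k" "a \<noteq> b"
    note fij = fl[OF ij] and Mij = Mu[OF ij(3)]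
    show "w a b \<in> M i j \<longleftrightarrow> {a, b} = {i, j}"
    proof (cases "u a b = u i j")
      case True
      then have "{a, b} = {i, j}" by (auto simp: u_def min_def max_def split: if_splits)
      moreover have "w a b \<in> M i j" using True meet(2,3)[OF fij(1)] Mij by (auto simp: w_def)
      ultimately show ?thesis by simp
    next
      case False
      then have "{a, b} \<noteq> {i, j}" by (auto simp: u_def min_def max_def doubleton_eq_iff split: if_splits)
      moreover have "w a b \<notin> M i j"
        using f(2)[OF uI[OF ab] uI[OF ij] False] Mij by (auto simp: w_def conflict_def)
      ultimately show ?thesis by simp
    qed
  qed
  then show ?thesis by blast
qed

end

section \<open>Points joined to many others\<close>

context linear_space
begin

text \<open>The relation used to select branch points. The set \<open>E\<close> of admitted incidences is a parameter, since
different branch points will use disjoint sets of incidences.\<close>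

definition joined :: "('a \<times> 'a set) set \<Rightarrow> nat \<Rightarrow> 'a \<Rightarrow> 'a \<Rightarrow> bool" where
  "joined E m x y \<longleftrightarrow> \<not> heavy m x y \<and>
     (\<exists>L q L'. (x, L) \<in> E \<and> (q, L) \<in> E \<and> (q, L') \<in> E \<and> (y, L') \<in> E \<and> y \<notin> L \<and> x \<notin> L')"

definition collinear_with :: "'a \<Rightarrow> 'a set" where
  "collinear_with q = (\<Union>L\<in>{L \<in> \<L>. q \<in> L}. L \<inter> P)"

lemma finite_collinear_with [simp]: "finite (collinear_with q)"
  using finite_lines finite_points by (auto simp: collinear_with_def)

lemma card_collinear_with:
  assumes "card {L \<in> \<L>. q \<in> L} \<le> \<Delta>\<^sub>1" "\<And>L. L \<in> \<L> \<Longrightarrow> card (L \<inter> P) \<le> \<Delta>\<^sub>2"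
  shows "card (collinear_with q) \<le> \<Delta>\<^sub>1 * \<Delta>\<^sub>2"
proof -
  have "card (collinear_with q) \<le> (\<Sum>L\<in>{L \<in> \<L>. q \<in> L}. card (L \<inter> P))"
    unfolding collinear_with_def using finite_lines by (intro card_UN_le) auto
  also have "\<dots> \<le> (\<Sum>L\<in>{L \<in> \<L>. q \<in> L}. \<Delta>\<^sub>2)" using assms(2) by (intro sum_mono) auto
  also have "\<dots> \<le> \<Delta>\<^sub>1 * \<Delta>\<^sub>2" using assms(1) by simp
  finally show ?thesis .
qed

text \<open>The middle point of a path is determined by its two lines.\<close>

lemma card_poor_meets:
  assumes "\<not> heavy m x y"
  shows "card {q \<in> P. \<exists>(L, L') \<in> links x y. q \<in> L \<and> q \<in> L' \<and>
     card (lines_meeting L y) \<le> m \<and> card (lines_meeting L' x) \<le> m} \<le> 2 * m\<^sup>2"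
    (is "card ?Q \<le> _")
proof -
  let ?K = "{(L, L') \<in> links x y. card (lines_meeting L y) \<le> m \<and> card (lines_meeting L' x) \<le> m}"
  have finK: "finite ?K" by (rule finite_subset[OF _ finite_links[of x y]]) auto
  have "card ?Q \<le> card (\<Union>e\<in>?K. fst e \<inter> snd e \<inter> P)"
    using finite_points finK by (intro card_mono) auto
  also have "\<dots> \<le> (\<Sum>e\<in>?K. card (fst e \<inter> snd e \<inter> P))" by (rule card_UN_le[OF finK])
  also have "\<dots> \<le> (\<Sum>e\<in>?K. 1)"
  proof (intro sum_mono card_le_1_if_all_equal)
    fix e p q assume e: "e \<in> ?K" and pq: "p \<in> fst e \<inter> snd e \<inter> P" "q \<in> fst e \<inter> snd e \<inter> P"
    have "e \<in> links x y" using e by auto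
    from linksD[OF this] have "fst e \<noteq> snd e" "fst e \<in> \<L>" "snd e \<in> \<L>" by auto
    then show "p = q" using unique_line[of p q "fst e" "snd e"] pq by blast
  qed
  also have "\<dots> \<le> 2 * m\<^sup>2" using card_poor_links_light[OF assms] by simp
  finally show ?thesis .
qed

context
  fixes t m \<Delta>\<^sub>1 \<Delta>\<^sub>2 :: nat and D :: real and E X
  assumes t: "0 < t" and m: "0 < m" and D: "0 < D"
    and no_clique: "\<not> (\<exists>S\<subseteq>P. card S = Suc t \<and> (\<forall>a\<in>S. \<forall>b\<in>S. a \<noteq> b \<longrightarrow> heavy m a b))"
    and E: "E \<subseteq> {(p, L). p \<in> P \<and> L \<in> \<L> \<and> p \<in> L}"
    and X: "X \<subseteq> P" "X \<noteq> {}"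
    and degree: "\<And>x. x \<in> X \<Longrightarrow> D \<le> real (card {L. (x, L) \<in> E})"
    and point_degree: "\<And>x. x \<in> P \<Longrightarrow> card {L \<in> \<L>. x \<in> L} \<le> \<Delta>\<^sub>1"
    and line_degree: "\<And>L. L \<in> \<L> \<Longrightarrow> card (L \<inter> P) \<le> \<Delta>\<^sub>2"
begin

lemma finX: "finite X" using X finite_points finite_subset by blast

lemma cardX: "0 < card X" using X finX by (simp add: card_gt_0_iff)

definition light_neighbours :: "'a \<Rightarrow> 'a set" where
  "light_neighbours q = {x \<in> X. q \<noteq> x \<and> \<not> heavy m q x \<and> (\<exists>L. (q, L) \<in> E \<and> (x, L) \<in> E)}"

text \<open>Turan's theorem on the points of \<open>X\<close> on each line, summed over all lines with the Cauchy-Schwarz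
inequality. The density hypothesis makes the average line long enough for the diagonal pairs to be
at most half of the total.\<close>

lemma many_light_neighbours:
  assumes dense: "2 * real t * real (card \<L>) \<le> D * real (card X)"
  shows "(D * real (card X))\<^sup>2 / (2 * real t * real (card \<L>)) \<le> (\<Sum>q\<in>X. real (card (light_neighbours q)))"
proof -
  define R where "R L = {x \<in> X. (x, L) \<in> E}" for L
  define S where "S = (\<Sum>L\<in>\<L>. real (card (R L)))"
  define N where "N L = {(q, x). q \<in> R L \<and> x \<in> R L \<and> q \<noteq> x \<and> \<not> heavy m q x}" for L
  define W where "W = (\<Sum>q\<in>X. real (card (light_neighbours q)))"
  let ?l = "real (card \<L>)"
  have finR: "finite (R L)" for L using finX by (simp add: R_def)
  have finN: "finite (N L)" for L
    by (rule finite_subset[OF _ finite_cartesian_product[OF finR[of L] finR[of L]]]) (auto simp: N_def)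
  have "S = real (\<Sum>L\<in>\<L>. card (R L))" by (simp add: S_def)
  also have "(\<Sum>L\<in>\<L>. card (R L)) = (\<Sum>x\<in>X. card {L \<in> \<L>. (x, L) \<in> E})"
    unfolding R_def by (rule sum_multicount_gen) (auto simp: finX finite_lines)
  also have "real \<dots> = (\<Sum>x\<in>X. real (card {L. (x, L) \<in> E}))"
  proof -
    have "{L \<in> \<L>. (x, L) \<in> E} = {L. (x, L) \<in> E}" for x using E by auto
    then show ?thesis by simp
  qed
  finally have "(\<Sum>x\<in>X. D) \<le> S" using degree by (simp only:) (intro sum_mono, auto)
  then have S: "D * real (card X) \<le> S" by (simp add: mult.commute)
  have Spos: "0 < S" using S D cardX by (smt (verit) mult_pos_pos of_nat_0_less_iff)
  have lpos: "0 < ?l"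
    using Spos finite_lines by (cases "\<L> = {}") (auto simp: S_def card_gt_0_iff)
  have Turan: "(real (card (R L)))\<^sup>2 / real t - real (card (R L)) \<le> real (card (N L))" if "L \<in> \<L>" for L
  proof -
    have "R L \<subseteq> P" using X by (auto simp: R_def)
    then have "\<not> (\<exists>S\<subseteq>R L. card S = Suc t \<and> (\<forall>a\<in>S. \<forall>b\<in>S. a \<noteq> b \<longrightarrow> heavy m a b))"
      using no_clique by (meson subset_trans)
    then have "(card (R L))\<^sup>2 \<le> t * card {(a, b) \<in> R L \<times> R L. \<not> heavy m a b}"
      by (intro many_nonadjacent_pairs_if_no_clique[OF finR heavy_sym not_heavy_self[OF m]])
    also have "card {(a, b) \<in> R L \<times> R L. \<not> heavy m a b} \<le> card (N L \<union> (\<lambda>a. (a, a)) ` R L)"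
      using finN finR by (intro card_mono) (auto simp: N_def)
    also have "\<dots> \<le> card (N L) + card (R L)"
      using card_Un_le[of "N L" "(\<lambda>a. (a, a)) ` R L"] card_image_le[OF finR, of "\<lambda>a. (a, a)" L] by linarith
    finally have "real ((card (R L))\<^sup>2) \<le> real (t * (card (N L) + card (R L)))" by (simp only: of_nat_le_iff mult_le_mono2)
    then show ?thesis using t by (simp add: field_simps)
  qed
  \<comment> \<open>A pair of distinct points lies on at most one line, so no pair is counted twice.\<close>
  have "(\<Sum>L\<in>\<L>. card (N L)) = card (\<Union>L\<in>\<L>. N L)"
  proof (rule card_UN_disjoint[symmetric])
    show "\<forall>L\<in>\<L>. \<forall>L'\<in>\<L>. L \<noteq> L' \<longrightarrow> N L \<inter> N L' = {}"
    proof (intro ballI impI)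
      fix L L' assume L: "L \<in> \<L>" "L' \<in> \<L>" "L \<noteq> L'"
      show "N L \<inter> N L' = {}"
      proof (rule equals0I)
        fix e assume "e \<in> N L \<inter> N L'"
        then obtain q x where "q \<in> R L" "x \<in> R L" "q \<in> R L'" "x \<in> R L'" "q \<noteq> x" by (auto simp: N_def)
        then show False using unique_line[of q x L L'] L E by (auto simp: R_def)
      qed
    qed
  qed (auto simp: finN finite_lines)
  also have "\<dots> \<le> card (Sigma X light_neighbours)"
    using finX by (intro card_mono finite_SigmaI) (auto simp: light_neighbours_def N_def R_def)
  also have "\<dots> = (\<Sum>q\<in>X. card (light_neighbours q))"
    using finX by (intro card_SigmaI) (auto simp: light_neighbours_def)
  finally have NW: "(\<Sum>L\<in>\<L>. real (card (N L))) \<le> W"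
    unfolding W_def by (simp flip: of_nat_sum)
  have "S\<^sup>2 \<le> ?l * (\<Sum>L\<in>\<L>. (real (card (R L)))\<^sup>2)"
    unfolding S_def by (metis sum_squared_le_sum_of_squares mult.commute)
  then have "S\<^sup>2 / ?l \<le> (\<Sum>L\<in>\<L>. (real (card (R L)))\<^sup>2)" using lpos by (simp add: field_simps)
  then have "S\<^sup>2 / ?l / real t \<le> (\<Sum>L\<in>\<L>. (real (card (R L)))\<^sup>2) / real t"
    using t by (intro divide_right_mono) auto
  then have "S\<^sup>2 / ?l / real t - S \<le> (\<Sum>L\<in>\<L>. (real (card (R L)))\<^sup>2 / real t - real (card (R L)))"
    by (simp add: S_def sum_subtractf sum_divide_distrib)
  also have "\<dots> \<le> (\<Sum>L\<in>\<L>. real (card (N L)))" by (intro sum_mono Turan)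
  finally have W: "S\<^sup>2 / ?l / real t - S \<le> W" using NW by linarith
  have "2 * real t * ?l * S \<le> S * S" using dense S Spos by (intro mult_right_mono) auto
  then have "S \<le> S\<^sup>2 / (2 * real t * ?l)" using lpos t by (simp add: field_simps power2_eq_square)
  moreover have "S\<^sup>2 / ?l / real t = 2 * (S\<^sup>2 / (2 * real t * ?l))" using lpos t by (simp add: field_simps)
  ultimately have "S\<^sup>2 / (2 * real t * ?l) \<le> W" using W by linarith
  moreover have "(D * real (card X))\<^sup>2 \<le> S\<^sup>2" using S D by (intro power_mono) auto
  then have "(D * real (card X))\<^sup>2 / (2 * real t * ?l) \<le> S\<^sup>2 / (2 * real t * ?l)"
    by (intro divide_right_mono) auto
  ultimately show ?thesis by (simp add: W_def)
qed

definition light_triples :: "('a \<times> 'a \<times> 'a) set" where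
  "light_triples = Sigma X (\<lambda>q. {(x, y) \<in> light_neighbours q \<times> light_neighbours q. \<not> heavy m x y})"

lemma finite_light_neighbours: "finite (light_neighbours q)"
  using finX by (simp add: light_neighbours_def)

text \<open>Turan's theorem once more, now inside the set of light neighbours of each point.\<close>

lemma many_light_triples:
  assumes dense: "2 * real t * real (card \<L>) \<le> D * real (card X)"
  shows "D ^ 4 * real (card X) ^ 3 / (4 * real t ^ 3 * real (card \<L>) ^ 2) \<le> real (card light_triples)"
proof -
  let ?n = "real (card X)" and ?l = "real (card \<L>)"
  define W where "W = (\<Sum>q\<in>X. real (card (light_neighbours q)))"
  define T where "T q = {(x, y) \<in> light_neighbours q \<times> light_neighbours q. \<not> heavy m x y}" for q
  have finT: "finite (T q)" for q
    by (rule finite_subset[OF _ finite_cartesian_product[OF finite_light_neighbours[of q] finite_light_neighbours[of q]]])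
       (auto simp: T_def)
  have Turan: "(real (card (light_neighbours q)))\<^sup>2 \<le> real t * real (card (T q))" for q
  proof -
    have "light_neighbours q \<subseteq> P" using X by (auto simp: light_neighbours_def)
    then have "\<not> (\<exists>S\<subseteq>light_neighbours q. card S = Suc t \<and> (\<forall>a\<in>S. \<forall>b\<in>S. a \<noteq> b \<longrightarrow> heavy m a b))"
      using no_clique by (meson subset_trans)
    then have "(card (light_neighbours q))\<^sup>2 \<le> t * card (T q)"
      unfolding T_def
      by (intro many_nonadjacent_pairs_if_no_clique[OF finite_light_neighbours heavy_sym not_heavy_self[OF m]])
    then show ?thesis by (simp flip: of_nat_mult of_nat_power)
  qed
  have card: "real (card light_triples) = (\<Sum>q\<in>X. real (card (T q)))"
    unfolding light_triples_def T_def[symmetric] using finX finT by (simp add: card_SigmaI)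
  have "W\<^sup>2 \<le> ?n * (\<Sum>q\<in>X. (real (card (light_neighbours q)))\<^sup>2)"
    unfolding W_def by (metis sum_squared_le_sum_of_squares mult.commute)
  also have "\<dots> \<le> ?n * (\<Sum>q\<in>X. real t * real (card (T q)))"
    using Turan by (intro mult_left_mono sum_mono) auto
  also have "\<dots> = ?n * real t * real (card light_triples)" by (simp add: card sum_distrib_left mult.assoc)
  finally have W2: "W\<^sup>2 \<le> ?n * real t * real (card light_triples)" .
  have "((D * ?n)\<^sup>2 / (2 * real t * ?l))\<^sup>2 \<le> W\<^sup>2"
    using many_light_neighbours[OF dense] unfolding W_def by (intro power_mono) auto
  with W2 have le: "((D * ?n)\<^sup>2 / (2 * real t * ?l))\<^sup>2 \<le> ?n * real t * real (card light_triples)" by linarith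
  have "D ^ 4 * ?n ^ 3 / (4 * real t ^ 3 * ?l ^ 2) = ((D * ?n)\<^sup>2 / (2 * real t * ?l))\<^sup>2 / (?n * real t)"
    using cardX t by (simp add: field_simps power_divide power_mult_distrib eval_nat_numeral)
  also have "\<dots> \<le> real (card light_triples)"
    using le cardX t by (simp add: divide_le_eq mult_ac)
  finally show ?thesis .
qed

text \<open>This number and that of the rich triples below should be compared with the number of light
triples, which in a dense system is larger by a factor of about the degree of a point.\<close>

lemma few_triples_on_a_line:
  "card {(q, x, y). q \<in> X \<and> x \<in> P \<and> y \<in> P \<and> (\<exists>L\<in>\<L>. q \<in> L \<and> x \<in> L \<and> y \<in> L)}
    \<le> card X * (\<Delta>\<^sub>1 * (\<Delta>\<^sub>2 * \<Delta>\<^sub>2))" (is "card ?B \<le> _")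
proof -
  let ?U = "\<lambda>q. \<Union>L\<in>{L \<in> \<L>. q \<in> L}. (L \<inter> P) \<times> (L \<inter> P)"
  have fin: "finite (?U q)" for q using finite_lines finite_points by auto
  have U: "card (?U q) \<le> \<Delta>\<^sub>1 * (\<Delta>\<^sub>2 * \<Delta>\<^sub>2)" if "q \<in> X" for q
  proof -
    have "card (?U q) \<le> (\<Sum>L\<in>{L \<in> \<L>. q \<in> L}. card ((L \<inter> P) \<times> (L \<inter> P)))"
      using finite_lines by (intro card_UN_le) auto
    also have "\<dots> \<le> (\<Sum>L\<in>{L \<in> \<L>. q \<in> L}. \<Delta>\<^sub>2 * \<Delta>\<^sub>2)"
      using line_degree by (intro sum_mono) (auto simp: card_cartesian_product intro: mult_mono)
    also have "\<dots> \<le> \<Delta>\<^sub>1 * (\<Delta>\<^sub>2 * \<Delta>\<^sub>2)" using point_degree that X by (auto intro: mult_right_mono)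
    finally show ?thesis .
  qed
  have "card ?B \<le> card (Sigma X ?U)" using finX fin by (intro card_mono finite_SigmaI) auto
  also have "\<dots> = (\<Sum>q\<in>X. card (?U q))" using finX fin by (intro card_SigmaI) auto
  also have "\<dots> \<le> (\<Sum>q\<in>X. \<Delta>\<^sub>1 * (\<Delta>\<^sub>2 * \<Delta>\<^sub>2))" by (intro sum_mono U)
  finally show ?thesis by simp
qed

text \<open>The triples discarded because the line through \<open>q\<close> and \<open>x\<close> reaches \<open>y\<close> in too many ways. The
order of the components is the order in which they are counted: few lines through \<open>q\<close> are rich for
\<open>y\<close>, so that \<open>x\<close> is counted last.\<close>

definition rich_triples :: "('a \<times> 'a \<times> 'a) set" where
  "rich_triples = {(q, y, x). q \<in> X \<and> x \<in> P \<and> y \<in> collinear_with q \<and> q \<noteq> y \<and> \<not> heavy m q y \<and>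
     (\<exists>L\<in>\<L>. q \<in> L \<and> x \<in> L \<and> y \<notin> L \<and> m < card (lines_meeting L y))}"

lemma few_rich_triples:
  "finite rich_triples" "card rich_triples \<le> card X * ((\<Delta>\<^sub>1 * \<Delta>\<^sub>2) * (m * \<Delta>\<^sub>2))"
proof -
  let ?R = "\<lambda>q y. {L \<in> \<L>. q \<in> L \<and> y \<notin> L \<and> m < card (lines_meeting L y)}"
  let ?C = "\<lambda>q. {y \<in> collinear_with q. q \<noteq> y \<and> \<not> heavy m q y}"
  let ?U = "\<lambda>q y. \<Union>L\<in>?R q y. L \<inter> P"
  have finU: "finite (?U q y)" for q y using finite_lines finite_points by auto
  have finC: "finite (?C q)" for q using finite_collinear_with by auto
  have U: "card (?U q y) \<le> m * \<Delta>\<^sub>2" if "q \<in> X" "y \<in> ?C q" for q y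
  proof -
    have "card (?U q y) \<le> (\<Sum>L\<in>?R q y. card (L \<inter> P))"
      using finite_lines by (intro card_UN_le) auto
    also have "\<dots> \<le> (\<Sum>L\<in>?R q y. \<Delta>\<^sub>2)" using line_degree by (intro sum_mono) auto
    also have "\<dots> = card (?R q y) * \<Delta>\<^sub>2" by simp
    also have "\<dots> \<le> m * \<Delta>\<^sub>2"
      using that X by (intro mult_right_mono card_rich_lines_light) (auto simp: collinear_with_def)
    finally show ?thesis .
  qed
  have V: "card (Sigma (?C q) (?U q)) \<le> (\<Delta>\<^sub>1 * \<Delta>\<^sub>2) * (m * \<Delta>\<^sub>2)" if "q \<in> X" for q
  proof -
    have "card (Sigma (?C q) (?U q)) = (\<Sum>y\<in>?C q. card (?U q y))"
      using finC finU by (intro card_SigmaI) auto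
    also have "\<dots> \<le> (\<Sum>y\<in>?C q. m * \<Delta>\<^sub>2)" by (intro sum_mono U[OF that]) 
    also have "\<dots> = card (?C q) * (m * \<Delta>\<^sub>2)" by simp
    also have "card (?C q) \<le> card (collinear_with q)"
      using finite_collinear_with by (intro card_mono) auto
    also have "\<dots> \<le> \<Delta>\<^sub>1 * \<Delta>\<^sub>2" using that X by (intro card_collinear_with point_degree line_degree) auto
    finally show ?thesis by (simp add: mult_right_mono)
  qed
  have sub: "rich_triples \<subseteq> Sigma X (\<lambda>q. Sigma (?C q) (?U q))" by (auto simp: rich_triples_def)
  have fin: "finite (Sigma X (\<lambda>q. Sigma (?C q) (?U q)))"
    using finX finC finU by (intro finite_SigmaI) auto
  show "finite rich_triples" using finite_subset[OF sub fin] .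
  have "card rich_triples \<le> card (Sigma X (\<lambda>q. Sigma (?C q) (?U q)))" using card_mono[OF fin sub] .
  also have "\<dots> = (\<Sum>q\<in>X. card (Sigma (?C q) (?U q)))"
    using finX finC finU by (intro card_SigmaI ballI finite_SigmaI) auto
  also have "\<dots> \<le> (\<Sum>q\<in>X. (\<Delta>\<^sub>1 * \<Delta>\<^sub>2) * (m * \<Delta>\<^sub>2))" by (intro sum_mono V)
  finally show "card rich_triples \<le> card X * ((\<Delta>\<^sub>1 * \<Delta>\<^sub>2) * (m * \<Delta>\<^sub>2))" by simp
qed

text \<open>Of the light triples, at most half are degenerate or rich. The middle point of each of the others is
one of at most \<open>2 * m\<^sup>2\<close> for its pair of end points, so that many pairs are joined, and a point with an
average number of partners is as claimed.\<close>

lemma point_joined_to_many: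
  assumes dense: "2 * real t * real (card \<L>) \<le> D * real (card X)"
    and big: "8 * real t ^ 3 * (2 * real m + 1) * real \<Delta>\<^sub>1 * real \<Delta>\<^sub>2 ^ 2 * real (card \<L>) ^ 2
        \<le> D ^ 4 * real (card X) ^ 2"
  shows "\<exists>x\<in>X. D ^ 4 * real (card X) ^ 2 / (16 * real m ^ 2 * real t ^ 3 * real (card \<L>) ^ 2)
     \<le> real (card {y \<in> X. joined E m x y})"
proof -
  let ?n = "real (card X)" and ?l = "real (card \<L>)"
  define B where "B = {(q, x, y). q \<in> X \<and> x \<in> P \<and> y \<in> P \<and> (\<exists>L\<in>\<L>. q \<in> L \<and> x \<in> L \<and> y \<in> L)}"
  define swap where "swap = (\<lambda>(q :: 'a, y :: 'a, x :: 'a). (q, x, y))"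
  define good where "good = light_triples - B - rich_triples - swap ` rich_triples"
  define N where "N = Sigma X (\<lambda>x. {y \<in> X. joined E m x y})"
  define Q where "Q x y = {q \<in> P. \<exists>(L, L') \<in> links x y. q \<in> L \<and> q \<in> L' \<and>
     card (lines_meeting L y) \<le> m \<and> card (lines_meeting L' x) \<le> m}" for x y
  have finQ: "finite (Q x y)" for x y using finite_points by (auto simp: Q_def)
  have finN: "finite N" using finX by (auto simp: N_def)
  have fintr: "finite light_triples"
    unfolding light_triples_def using finX finite_light_neighbours
    by (intro finite_SigmaI) (auto intro: finite_subset[OF _ finite_cartesian_product])
  have finB: "finite B"
    by (rule finite_subset[of _ "P \<times> P \<times> P"]) (use X finite_points in \<open>auto simp: B_def\<close>)
  have lpos: "0 < ?l"
  proof -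
    obtain x where "x \<in> X" using X by auto
    then have "0 < real (card {L. (x, L) \<in> E})" using degree[of x] D by linarith
    then have "{L. (x, L) \<in> E} \<noteq> {}" by (metis card.empty less_irrefl of_nat_0)
    then have "\<L> \<noteq> {}" using E by auto
    then show ?thesis using finite_lines by (simp add: card_gt_0_iff)
  qed
  \<comment> \<open>The end points of a good triple are joined, and its middle point is on the lines of a poor link.\<close>
  have "good \<subseteq> (\<Union>p\<in>N. (\<lambda>q. (q, fst p, snd p)) ` Q (fst p) (snd p))"
  proof
    fix g assume g: "g \<in> good"
    then obtain q x y where gq: "g = (q, x, y)" and tr: "(q, x, y) \<in> light_triples"
      and nB: "(q, x, y) \<notin> B" and r1: "(q, x, y) \<notin> rich_triples" and r2: "(q, y, x) \<notin> rich_triples"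
      by (cases g) (force simp: good_def swap_def)
    from tr have q: "q \<in> X" and x: "x \<in> X" "q \<noteq> x" "\<not> heavy m q x" and y: "y \<in> X" "q \<noteq> y" "\<not> heavy m q y"
      and xy: "\<not> heavy m x y" by (auto simp: light_triples_def light_neighbours_def)
    from tr obtain L L' where L: "(q, L) \<in> E" "(x, L) \<in> E" and L': "(q, L') \<in> E" "(y, L') \<in> E"
      by (auto simp: light_triples_def light_neighbours_def)
    have inc: "L \<in> \<L>" "q \<in> L" "x \<in> L" "L' \<in> \<L>" "q \<in> L'" "y \<in> L'" "q \<in> P" "x \<in> P" "y \<in> P"
      using L L' E by auto
    have yL: "y \<notin> L" using nB inc q by (auto simp: B_def)
    have xL': "x \<notin> L'" using nB inc q by (auto simp: B_def)
    have "card (lines_meeting L y) \<le> m"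
      using r2 inc q y yL unfolding rich_triples_def collinear_with_def by force
    moreover have "card (lines_meeting L' x) \<le> m"
      using r1 inc q x xL' unfolding rich_triples_def collinear_with_def by force
    moreover have "(L, L') \<in> links x y" using inc yL xL' by (auto simp: links_def)
    ultimately have "q \<in> Q x y" using inc by (auto simp: Q_def)
    moreover have "(x, y) \<in> N"
      using x y xy L L' yL xL' by (auto simp: N_def joined_def)
    ultimately show "g \<in> (\<Union>p\<in>N. (\<lambda>q. (q, fst p, snd p)) ` Q (fst p) (snd p))"
      using gq by force
  qed
  then have "card good \<le> card (\<Union>p\<in>N. (\<lambda>q. (q, fst p, snd p)) ` Q (fst p) (snd p))"
    using finN finQ by (intro card_mono) auto
  also have "\<dots> \<le> (\<Sum>p\<in>N. card ((\<lambda>q. (q, fst p, snd p)) ` Q (fst p) (snd p)))"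
    by (rule card_UN_le[OF finN])
  also have "\<dots> \<le> (\<Sum>p\<in>N. 2 * m\<^sup>2)"
  proof (rule sum_mono)
    fix p assume "p \<in> N"
    then have "\<not> heavy m (fst p) (snd p)" by (auto simp: N_def joined_def)
    from card_poor_meets[OF this] have "card (Q (fst p) (snd p)) \<le> 2 * m\<^sup>2" by (simp only: Q_def)
    then show "card ((\<lambda>q. (q, fst p, snd p)) ` Q (fst p) (snd p)) \<le> 2 * m\<^sup>2"
      by (rule order_trans[OF card_image_le[OF finQ]])
  qed
  finally have "real (card good) \<le> real (card N * (2 * m\<^sup>2))" by (simp only: of_nat_le_iff sum_constant of_nat_id)
  then have good_le: "real (card good) \<le> real (card N) * (2 * real m ^ 2)" by simp
  have "card light_triples \<le> card (good \<union> (B \<union> (rich_triples \<union> swap ` rich_triples)))"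
    using fintr finB few_rich_triples(1) by (intro card_mono) (auto simp: good_def)
  also have "\<dots> \<le> card good + (card B + (card rich_triples + card (swap ` rich_triples)))"
    by (meson add_left_mono card_Un_le le_trans)
  also have "card (swap ` rich_triples) \<le> card rich_triples"
    by (rule card_image_le[OF few_rich_triples(1)])
  finally have "card light_triples \<le> card good + (card B + 2 * card rich_triples)" by simp
  also have "\<dots> \<le> card good + (card X * (\<Delta>\<^sub>1 * (\<Delta>\<^sub>2 * \<Delta>\<^sub>2)) + 2 * (card X * ((\<Delta>\<^sub>1 * \<Delta>\<^sub>2) * (m * \<Delta>\<^sub>2))))"
    using few_triples_on_a_line few_rich_triples(2) unfolding B_def[symmetric] by (intro add_mono mult_left_mono) auto
  also have "\<dots> = card good + card X * (\<Delta>\<^sub>1 * \<Delta>\<^sub>2\<^sup>2 * (2 * m + 1))"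
    by (simp add: power2_eq_square algebra_simps)
  finally have "real (card light_triples) \<le> real (card good + card X * (\<Delta>\<^sub>1 * \<Delta>\<^sub>2\<^sup>2 * (2 * m + 1)))"
    by (simp only: of_nat_le_iff)
  then have lt: "real (card light_triples) \<le> real (card good) + ?n * (real \<Delta>\<^sub>1 * real \<Delta>\<^sub>2 ^ 2 * (2 * real m + 1))"
    by (simp add: algebra_simps)
  define c where "c = D ^ 4 * ?n ^ 2 / (8 * real t ^ 3 * ?l ^ 2)"
  have "real \<Delta>\<^sub>1 * real \<Delta>\<^sub>2 ^ 2 * (2 * real m + 1) \<le> c"
    using big lpos t unfolding c_def by (simp add: le_divide_eq mult_ac)
  then have "?n * (real \<Delta>\<^sub>1 * real \<Delta>\<^sub>2 ^ 2 * (2 * real m + 1)) \<le> ?n * c" by (intro mult_left_mono) auto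
  moreover have "2 * (?n * c) \<le> real (card light_triples)"
  proof -
    have "2 * (?n * c) = D ^ 4 * ?n ^ 3 / (4 * real t ^ 3 * ?l ^ 2)"
      using lpos t by (simp add: c_def field_simps eval_nat_numeral)
    then show ?thesis using many_light_triples[OF dense] by simp
  qed
  ultimately have "?n * c \<le> real (card N) * (2 * real m ^ 2)" using lt good_le by linarith
  then have cN: "?n * (c / (2 * real m ^ 2)) \<le> real (card N)" using m by (simp add: field_simps)
  have ceq: "c / (2 * real m ^ 2) = D ^ 4 * ?n ^ 2 / (16 * real m ^ 2 * real t ^ 3 * ?l ^ 2)"
    using m t lpos by (simp add: c_def field_simps)
  show ?thesis
  proof (rule ccontr)
    assume "\<not> ?thesis"
    then have less: "real (card {y \<in> X. joined E m x y}) < c / (2 * real m ^ 2)" if "x \<in> X" for x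
      using that ceq by (auto simp: not_le)
    have "card N = (\<Sum>x\<in>X. card {y \<in> X. joined E m x y})"
      unfolding N_def using finX by (intro card_SigmaI) auto
    then have "real (card N) = (\<Sum>x\<in>X. real (card {y \<in> X. joined E m x y}))" by simp
    also have "\<dots> < (\<Sum>x\<in>X. c / (2 * real m ^ 2))"
      using finX X less by (intro sum_strict_mono) auto
    also have "\<dots> = ?n * (c / (2 * real m ^ 2))" by simp
    finally show False using cN by linarith
  qed
qed

end

end

section \<open>Adding a branch point\<close>

context linear_space
begin

definition old_points :: "nat \<Rightarrow> (nat \<Rightarrow> 'a) \<Rightarrow> (nat \<Rightarrow> nat \<Rightarrow> 'a) \<Rightarrow> 'a set" where
  "old_points j x w = x ` {..<j} \<union> {w a b | a b. a < j \<and> b < j \<and> a \<noteq> b}"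

text \<open>The points that must not be collinear with the next branch point, given the branch points \<open>x\<close> and
the middle points \<open>w\<close> so far: the points used already, the points on lines through two of these, and
the points in which paths from two different branch points can meet. If the middle point of a new
path is none of these, then the first halves of the new paths avoid each other and the old
structure.\<close>

definition danger :: "nat \<Rightarrow> (nat \<Rightarrow> 'a) \<Rightarrow> (nat \<Rightarrow> nat \<Rightarrow> 'a) \<Rightarrow> 'a set" where
  "danger j x w = old_points j x w
     \<union> (\<Union>L\<in>{L \<in> \<L>. \<exists>a\<in>old_points j x w. \<exists>b\<in>old_points j x w. a \<noteq> b \<and> a \<in> L \<and> b \<in> L}. L \<inter> P)
     \<union> (\<Union>(a, b)\<in>{(a, b). a < j \<and> b < j \<and> a \<noteq> b}.
          {q \<in> P. \<exists>(L, L') \<in> links (x a) (x b). q \<in> L \<and> q \<in> L'})"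

text \<open>A middle point \<open>q i\<close> is collinear with \<open>y\<close>, so it is not a dangerous point. If a first line \<open>L i\<close>
contained a second used point, or if an old line contained \<open>q i\<close>, then \<open>q i\<close> would be on a line through
two used points; if \<open>L l\<close> contained \<open>q i\<close>, then \<open>q i\<close> would be a meeting point of paths from \<open>x i\<close> and
\<open>x l\<close>. A last line \<open>L' i\<close> contains \<open>y\<close>, hence no used point, and it contains another \<open>q l\<close> only if it
equals \<open>L' l\<close>.\<close>

lemma induced_subdivision_extend:
  assumes ind: "induced_subdivision P \<L> j x M w" and y: "y \<in> P"
    and far: "\<And>z. z \<in> danger j x w \<Longrightarrow> y \<notin> collinear_with z"
    and path: "\<And>i. i < j \<Longrightarrow> L i \<in> \<L> \<and> L' i \<in> \<L> \<and> q i \<in> P \<and> x i \<in> L i \<and> q i \<in> L i \<and> q i \<in> L' i \<and>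
        y \<in> L' i \<and> y \<notin> L i \<and> x i \<notin> L' i"
    and distinct: "\<And>i l. i < j \<Longrightarrow> l < j \<Longrightarrow> i \<noteq> l \<Longrightarrow> L' i \<noteq> L' l"
  shows "\<exists>M' w'. induced_subdivision P \<L> (Suc j) (x(j := y)) M' w'"
proof -
  have indx: "x i \<in> P" if "i < j" for i using ind that by (simp add: induced_subdivision_def)
  have indM: "M a b \<in> \<L>" "w a b \<in> P" "w a b = w b a" if "a < j" "b < j" "a \<noteq> b" for a b
    using ind that unfolding induced_subdivision_def by metis+
  have xM: "x l \<in> M a b \<longleftrightarrow> l = a" if "a < j" "b < j" "a \<noteq> b" "l < j" for a b l
    using ind that unfolding induced_subdivision_def by metis
  have wM: "w c d \<in> M a b \<longleftrightarrow> {c, d} = {a, b}"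
    if "a < j" "b < j" "a \<noteq> b" "c < j" "d < j" "c \<noteq> d" for a b c d
    using ind that unfolding induced_subdivision_def by blast
  have wx: "w a b \<noteq> x l" if "a < j" "b < j" "a \<noteq> b" "l < j" for a b l
  proof
    assume eq: "w a b = x l"
    have "w a b \<in> M a b" "w a b \<in> M b a" using wM that by (auto simp: insert_commute)
    then show False using eq xM[of a b l] xM[of b a l] that by simp
  qed
  have oldx: "x i \<in> old_points j x w" if "i < j" for i using that by (auto simp: old_points_def)
  have oldw: "w a b \<in> old_points j x w" if "a < j" "b < j" "a \<noteq> b" for a b
    using that by (auto simp: old_points_def)
  have not_col: False if "z \<in> danger j x w" "K \<in> \<L>" "z \<in> K" "y \<in> K" for z K
    using far[OF that(1)] that(2-4) y by (auto simp: collinear_with_def)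
  have old_danger: "z \<in> danger j x w" if "z \<in> old_points j x w" for z using that by (simp add: danger_def)
  have line_danger: "z \<in> danger j x w"
    if "K \<in> \<L>" "a \<in> old_points j x w" "b \<in> old_points j x w" "a \<noteq> b" "a \<in> K" "b \<in> K" "z \<in> K" "z \<in> P" for K a b z
  proof -
    have "K \<in> {L \<in> \<L>. \<exists>a\<in>old_points j x w. \<exists>b\<in>old_points j x w. a \<noteq> b \<and> a \<in> L \<and> b \<in> L}"
      using that(1-6) by blast
    then have "z \<in> (\<Union>L\<in>{L \<in> \<L>. \<exists>a\<in>old_points j x w. \<exists>b\<in>old_points j x w. a \<noteq> b \<and> a \<in> L \<and> b \<in> L}. L \<inter> P)"
      using that(7,8) by (intro UN_I IntI)
    then show ?thesis unfolding danger_def by (intro UnI1 UnI2)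
  qed
  have meet_danger: "z \<in> danger j x w"
    if "a < j" "b < j" "a \<noteq> b" "z \<in> P" "(K, K') \<in> links (x a) (x b)" "z \<in> K" "z \<in> K'" for z a b K K'
  proof -
    have "(a, b) \<in> {(a, b). a < j \<and> b < j \<and> a \<noteq> b}" using that by simp
    moreover have "z \<in> {q \<in> P. \<exists>(L, L') \<in> links (x a) (x b). q \<in> L \<and> q \<in> L'}" using that(4-7) by blast
    ultimately have "z \<in> (\<Union>(a, b)\<in>{(a, b). a < j \<and> b < j \<and> a \<noteq> b}.
          {q \<in> P. \<exists>(L, L') \<in> links (x a) (x b). q \<in> L \<and> q \<in> L'})"
      by (intro UN_I[of "(a, b)"]) (simp_all only: prod.case)
    then show ?thesis unfolding danger_def by (intro UnI2)
  qed
  have q_safe: "q i \<notin> danger j x w" if "i < j" for i using not_col path[OF that] by blast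
  have xinj: "x a \<noteq> x b" if "a < j" "b < j" "a \<noteq> b" for a b
    using xM[of a b a] xM[of a b b] that by auto
  have F1: "x l \<in> L i \<longleftrightarrow> l = i" if "l < j" "i < j" for l i
  proof (cases "l = i")
    case False
    have "x l \<notin> L i"
      using line_danger[OF _ oldx[OF that(1)] oldx[OF that(2)] xinj[OF that False], of "L i" "q i"]
        path[OF that(2)] q_safe[OF that(2)] by blast
    then show ?thesis using False by simp
  qed (use path that in blast)
  have F3: "x l \<notin> L' i" if "l < j" "i < j" for l i
    using not_col[OF old_danger[OF oldx[OF that(1)]], of "L' i"] path[OF that(2)] by blast
  have F5: "y \<notin> M a b" if "a < j" "b < j" "a \<noteq> b" for a b
    using not_col[OF old_danger[OF oldx[OF that(1)]], of "M a b"] indM(1)[OF that] xM[OF that that(1)] by blast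
  have F6: "w a b \<notin> L i" if "a < j" "b < j" "a \<noteq> b" "i < j" for a b i
    using line_danger[OF _ oldw[OF that(1-3)] oldx[OF that(4)] wx[OF that], of "L i" "q i"]
      path[OF that(4)] q_safe[OF that(4)] by blast
  have F7: "w a b \<notin> L' i" if "a < j" "b < j" "a \<noteq> b" "i < j" for a b i
    using not_col[OF old_danger[OF oldw[OF that(1-3)]], of "L' i"] path[OF that(4)] by blast
  have F8: "q i \<notin> M a b" if "a < j" "b < j" "a \<noteq> b" "i < j" for a b i
    using line_danger[OF indM(1)[OF that(1-3)] oldw[OF that(1-3)] oldx[OF that(1)] wx[OF that(1-3) that(1)], of "q i"]
      path[OF that(4)] q_safe[OF that(4)] wM[OF that(1-3) that(1-3)] xM[OF that(1-3) that(1)] by blast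
  have F9: "q i \<in> L l \<longleftrightarrow> l = i" if "l < j" "i < j" for l i
  proof (cases "l = i")
    case False
    have "(L i, L l) \<in> links (x i) (x l)" if "q i \<in> L l"
      using path[OF \<open>i < j\<close>] path[OF \<open>l < j\<close>] F1 \<open>i < j\<close> \<open>l < j\<close> False that by (auto simp: links_def)
    then have "q i \<notin> L l"
      using meet_danger[OF that(2,1), of "q i" "L i" "L l"] False path[OF that(2)] q_safe[OF that(2)] by blast
    then show ?thesis using False by simp
  qed (use path that in blast)
  have F10: "q i \<in> L' l \<longleftrightarrow> l = i" if "l < j" "i < j" for l i
  proof (cases "l = i")
    case False
    have "q i \<noteq> y" using path[OF that(2)] by blast
    then have "q i \<notin> L' l"
      using unique_line[of "q i" y "L' i" "L' l"] path[OF that(2)] path[OF that(1)] y distinct[OF that] False by blast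
    then show ?thesis using False by simp
  qed (use path that in blast)
  define M' where "M' a b = (if a < j \<and> b < j then M a b else if b = j then L a else L' b)" for a b
  define w' where "w' a b = (if a < j \<and> b < j then w a b else q (min a b))" for a b
  have "induced_subdivision P \<L> (Suc j) (x(j := y)) M' w'"
    unfolding induced_subdivision_def
  proof (intro conjI allI impI)
    fix i assume "i < Suc j"
    then show "(x(j := y)) i \<in> P" using indx y by auto
  next
    fix a b assume ab: "a < Suc j" "b < Suc j" "a \<noteq> b"
    then consider "a < j" "b < j" | "a < j" "b = j" | "a = j" "b < j" by linarith
    note cases = this
    from cases show "M' a b \<in> \<L>" by cases (use indM path ab in \<open>auto simp: M'_def\<close>)
    from cases show "w' a b \<in> P" by cases (use indM path ab in \<open>auto simp: w'_def\<close>)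
    from cases show "w' a b = w' b a" by cases (use indM ab in \<open>auto simp: w'_def min.commute\<close>)
    fix l assume l: "l < Suc j"
    from cases show "(x(j := y)) l \<in> M' a b \<longleftrightarrow> l = a"
      by cases (use l ab xM F1 F3 F5 path in \<open>auto simp: M'_def less_Suc_eq\<close>)
  next
    fix a b c d assume ab: "a < Suc j" "b < Suc j" "a \<noteq> b" and cd: "c < Suc j" "d < Suc j" "c \<noteq> d"
    from ab consider "a < j" "b < j" | "a < j" "b = j" | "a = j" "b < j" by linarith
    note cases_ab = this
    from cd consider "c < j" "d < j" | "c < j" "d = j" | "c = j" "d < j" by linarith
    note cases_cd = this
    from cases_ab show "w' c d \<in> M' a b \<longleftrightarrow> {c, d} = {a, b}"
    proof cases
      case 1
      from cases_cd show ?thesis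
        by cases (use 1 ab cd wM F8 in \<open>auto simp: M'_def w'_def doubleton_eq_iff\<close>)
    next
      case 2
      from cases_cd show ?thesis
        by cases (use 2 ab cd F6 F9 in \<open>auto simp: M'_def w'_def doubleton_eq_iff\<close>)
    next
      case 3
      from cases_cd show ?thesis
        by cases (use 3 ab cd F7 F10 in \<open>auto simp: M'_def w'_def doubleton_eq_iff\<close>)
    qed
  qed
  then show ?thesis by blast
qed

text \<open>Up to a constant there are no more dangerous points than points on a line. For the meeting points
this is where the pairs of branch points have to be light.\<close>

lemma card_danger:
  assumes "x ` {..<j} \<subseteq> P" and light: "\<And>a b. a < j \<Longrightarrow> b < j \<Longrightarrow> a \<noteq> b \<Longrightarrow> \<not> heavy m (x a) (x b)"
    and "\<And>a b. a < j \<Longrightarrow> b < j \<Longrightarrow> a \<noteq> b \<Longrightarrow> w a b \<in> P"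
    and line_degree: "\<And>L. L \<in> \<L> \<Longrightarrow> card (L \<inter> P) \<le> \<Delta>" and "0 < \<Delta>"
  shows "finite (danger j x w)" "card (danger j x w) \<le> (4 * j ^ 4 + 2 * j\<^sup>2 + 2 * m * j\<^sup>2) * \<Delta>"
proof -
  let ?O = "old_points j x w"
  have OP: "?O \<subseteq> P" using assms(1,3) by (auto simp: old_points_def)
  have finO: "finite ?O" using OP finite_points finite_subset by blast
  have O: "card ?O \<le> 2 * j\<^sup>2"
  proof -
    have "?O \<subseteq> x ` {..<j} \<union> (\<lambda>(a, b). w a b) ` ({..<j} \<times> {..<j})" by (auto simp: old_points_def)
    then have "card ?O \<le> card (x ` {..<j} \<union> (\<lambda>(a, b). w a b) ` ({..<j} \<times> {..<j}))"
      by (intro card_mono) auto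
    also have "\<dots> \<le> card (x ` {..<j}) + card ((\<lambda>(a, b). w a b) ` ({..<j} \<times> {..<j}))" by (rule card_Un_le)
    also have "\<dots> \<le> card {..<j} + card ({..<j} \<times> {..<j})" by (intro add_mono card_image_le) auto
    also have "\<dots> = j + j * j" by simp
    also have "\<dots> \<le> 2 * j\<^sup>2" by (simp add: power2_eq_square)
    finally show ?thesis .
  qed
  define K where "K = {L \<in> \<L>. \<exists>a\<in>?O. \<exists>b\<in>?O. a \<noteq> b \<and> a \<in> L \<and> b \<in> L}"
  have finK: "finite K" using finite_lines by (simp add: K_def)
  have K: "card K \<le> 4 * j ^ 4"
  proof -
    define K' where "K' p = {L \<in> \<L>. fst p \<noteq> snd p \<and> fst p \<in> L \<and> snd p \<in> L}" for p :: "'a \<times> 'a"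
    have "card K \<le> card (\<Union>p\<in>?O \<times> ?O. K' p)"
      using finO finite_lines by (intro card_mono) (auto simp: K_def K'_def)
    also have "\<dots> \<le> (\<Sum>p\<in>?O \<times> ?O. card (K' p))" using finO by (intro card_UN_le) auto
    also have "\<dots> \<le> (\<Sum>p\<in>?O \<times> ?O. 1)"
    proof (intro sum_mono card_le_1_if_all_equal)
      fix p L L' assume p: "p \<in> ?O \<times> ?O" "L \<in> K' p" "L' \<in> K' p"
      then have "fst p \<in> P" "snd p \<in> P" using OP by auto
      then show "L = L'" using unique_line[of "fst p" "snd p" L L'] p(2,3) by (simp add: K'_def)
    qed
    also have "\<dots> = card ?O * card ?O" by (simp add: card_cartesian_product)
    also have "\<dots> \<le> (2 * j\<^sup>2) * (2 * j\<^sup>2)" using O by (intro mult_mono) auto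
    also have "\<dots> = 4 * j ^ 4" by (simp add: eval_nat_numeral algebra_simps)
    finally show ?thesis .
  qed
  have KP: "card (\<Union>L\<in>K. L \<inter> P) \<le> 4 * j ^ 4 * \<Delta>"
  proof -
    have "card (\<Union>L\<in>K. L \<inter> P) \<le> (\<Sum>L\<in>K. card (L \<inter> P))" by (rule card_UN_le[OF finK])
    also have "\<dots> \<le> (\<Sum>L\<in>K. \<Delta>)" using line_degree by (intro sum_mono) (auto simp: K_def)
    also have "\<dots> \<le> 4 * j ^ 4 * \<Delta>" using K by simp
    finally show ?thesis .
  qed
  define I where "I = {(a, b). a < j \<and> b < j \<and> a \<noteq> b}"
  define Q where "Q p = {q \<in> P. \<exists>(L, L') \<in> links (x (fst p)) (x (snd p)). q \<in> L \<and> q \<in> L'}" for p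
  have Isub: "I \<subseteq> {..<j} \<times> {..<j}" by (auto simp: I_def)
  have finI: "finite I" using finite_subset[OF Isub] by simp
  have I: "card I \<le> j\<^sup>2" using card_mono[OF _ Isub] by (simp add: power2_eq_square)
  have QP: "card (\<Union>p\<in>I. Q p) \<le> j\<^sup>2 * (2 * m * \<Delta>)"
  proof -
    have "card (\<Union>p\<in>I. Q p) \<le> (\<Sum>p\<in>I. card (Q p))" by (rule card_UN_le[OF finI])
    also have "\<dots> \<le> (\<Sum>p\<in>I. 2 * m * \<Delta>)"
    proof (rule sum_mono)
      fix p assume "p \<in> I"
      then have "\<not> heavy m (x (fst p)) (x (snd p))" using light by (auto simp: I_def)
      then show "card (Q p) \<le> 2 * m * \<Delta>" unfolding Q_def by (rule card_meets_light[OF _ line_degree])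
    qed
    also have "\<dots> = card I * (2 * m * \<Delta>)" by simp
    also have "\<dots> \<le> j\<^sup>2 * (2 * m * \<Delta>)" using I by (rule mult_right_mono) simp
    finally show ?thesis .
  qed
  have eq: "danger j x w = ?O \<union> (\<Union>L\<in>K. L \<inter> P) \<union> (\<Union>p\<in>I. Q p)"
    unfolding danger_def K_def I_def Q_def by (simp add: case_prod_beta)
  show "finite (danger j x w)"
    unfolding eq using finO finK finI finite_points by (auto simp: Q_def)
  have "card (danger j x w) \<le> card ?O + card (\<Union>L\<in>K. L \<inter> P) + card (\<Union>p\<in>I. Q p)"
    unfolding eq by (meson add_right_mono card_Un_le le_trans)
  also have "\<dots> \<le> 2 * j\<^sup>2 + 4 * j ^ 4 * \<Delta> + j\<^sup>2 * (2 * m * \<Delta>)" using O KP QP by linarith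
  also have "2 * j\<^sup>2 \<le> 2 * j\<^sup>2 * \<Delta>" using \<open>0 < \<Delta>\<close> by simp
  finally show "card (danger j x w) \<le> (4 * j ^ 4 + 2 * j\<^sup>2 + 2 * m * j\<^sup>2) * \<Delta>"
    by (simp add: algebra_simps)
qed

end

section \<open>Selecting the branch points in a regular system\<close>

text \<open>A matching of this size suffices for \<open>heavy_clique_gives_subdivision\<close>. The constant
\<open>danger_const\<close> is the factor in the bound for the number of dangerous points, with
\<open>k\<close> in place of the number of branch points selected so far, and \<open>loss_const\<close> is large enough for all
estimates of the selection process.\<close>

definition matching_size :: "nat \<Rightarrow> nat" where
  "matching_size k = 2 * k ^ 4 + 2 * k + 1"

definition danger_const :: "nat \<Rightarrow> nat" where
  "danger_const k = 4 * k ^ 4 + 2 * k\<^sup>2 + 2 * matching_size k * k\<^sup>2"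

definition loss_const :: "nat \<Rightarrow> nat" where
  "loss_const k = 128 * k ^ 3 * (matching_size k)\<^sup>2 * (danger_const k + 1)"

context linear_space
begin

text \<open>After \<open>j\<close> selections at least a fraction \<open>\<eta> j = \<beta> ^ (2 ^ j - 1)\<close> of the points is left: at
least half of these are not excluded by dangerous points, and \<open>point_joined_to_many\<close> turns a fraction \<open>\<eta>\<close> into a
fraction \<open>\<beta> * \<eta>\<^sup>2\<close>, by the last hypothesis. All \<open>\<eta> j\<close> are at least \<open>\<sigma>\<close>. The first two of the
numerical hypotheses provide those of \<open>point_joined_to_many\<close>. Together with the upper bound on the
density, the second also keeps the number of excluded points below \<open>\<sigma> * card P / 2\<close>.\<close>

theorem dense_regular_gives_subdivision:
  fixes t D \<Delta>\<^sub>1 \<Delta>\<^sub>2 :: nat and \<beta> :: real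
  defines "k \<equiv> Suc t"
  defines "\<sigma> \<equiv> \<beta> ^ (2 ^ k)"
  assumes t: "0 < t" and P: "P \<noteq> {}" and D: "0 < D" and D2: "0 < \<Delta>\<^sub>2" and \<beta>: "0 < \<beta>" "\<beta> \<le> 1"
    and degree: "\<And>x. x \<in> P \<Longrightarrow> k * D \<le> card {L \<in> \<L>. x \<in> L}"
    and point_degree: "\<And>x. x \<in> P \<Longrightarrow> card {L \<in> \<L>. x \<in> L} \<le> \<Delta>\<^sub>1"
    and line_degree: "\<And>L. L \<in> \<L> \<Longrightarrow> card (L \<inter> P) \<le> \<Delta>\<^sub>2"
    and h1: "real (loss_const k) * real (card \<L>) \<le> real D * \<sigma> * real (card P)"
    and h2: "real (loss_const k) * (real \<Delta>\<^sub>1 * real \<Delta>\<^sub>2 ^ 2 * real (card \<L>) ^ 2)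
        \<le> real D ^ 4 * \<sigma> ^ 2 * real (card P) ^ 2"
    and h3: "real (loss_const k) * real (card \<L>) ^ 2 * \<beta> \<le> real D ^ 4 * real (card P)"
  shows "\<exists>x M w. induced_subdivision P \<L> k x M w"
proof -
  define m where "m = matching_size k"
  define n where "n = real (card P)"
  define l where "l = real (card \<L>)"
  define C where "C = real (danger_const k)"
  let ?d = "real D" and ?t = "real t" and ?m = "real m"
  have kt: "real k = ?t + 1" "k \<ge> 1" by (simp_all add: k_def)
  have mpos: "m \<ge> 1" by (simp add: m_def matching_size_def)
  have m1: "?m \<ge> 1" using mpos by simp
  have C0: "C \<ge> 0" by (simp add: C_def)
  have t1: "?t \<ge> 1" using t by simp
  have \<sigma>: "0 < \<sigma>" "\<sigma> \<le> 1" using \<beta> by (auto simp: \<sigma>_def power_le_one)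
  have npos: "n > 0" using P finite_points by (simp add: n_def card_gt_0_iff)
  have lpos: "l > 0"
  proof -
    obtain x where x: "x \<in> P" using P by auto
    have "0 < k * D" using D by (simp add: k_def)
    then have "0 < card {L \<in> \<L>. x \<in> L}" using degree[OF x] by linarith
    then have "\<L> \<noteq> {}" by (auto simp: card_gt_0_iff)
    then show ?thesis using finite_lines by (simp add: l_def card_gt_0_iff)
  qed
  have K: "real (loss_const k) \<ge> 128 * ?t ^ 3 * ?m ^ 2 * (C + 1)"
  proof -
    have "?t ^ 3 \<le> real k ^ 3" using kt t1 by (intro power_mono) auto
    then have "128 * ?t ^ 3 * ?m ^ 2 * (C + 1) \<le> 128 * real k ^ 3 * ?m ^ 2 * (C + 1)"
      using C0 by (intro mult_right_mono mult_left_mono) auto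
    also have "\<dots> = real (loss_const k)" by (simp add: loss_const_def m_def C_def algebra_simps)
    finally show ?thesis .
  qed
  have t3: "?t \<le> ?t ^ 3" using t1 by (simp add: self_le_power)
  have m2: "?m \<le> ?m ^ 2" using m1 by (simp add: self_le_power)
  have tm: "?t ^ 3 \<ge> 1" "?m ^ 2 \<ge> 1" using t1 m1 by (auto intro: one_le_power)
  define Z where "Z = ?t ^ 3 * ?m ^ 2"
  have Z: "Z \<ge> 1" "Z \<ge> ?t ^ 3 * ?m" "Z \<ge> ?t" "Z \<ge> ?t ^ 3"
  proof -
    show "Z \<ge> 1" using mult_mono[OF tm] by (simp add: Z_def)
    show "Z \<ge> ?t ^ 3 * ?m" unfolding Z_def using m2 by (intro mult_left_mono) auto
    show Zt: "Z \<ge> ?t ^ 3" unfolding Z_def using tm(2) tm(1) by (simp add: mult_le_cancel_left1)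
    show "Z \<ge> ?t" using t3 Zt by linarith
  qed
  have KZ: "real (loss_const k) \<ge> 128 * Z * (C + 1)" using K by (simp add: Z_def mult_ac)
  have KZ1: "real (loss_const k) \<ge> 128 * Z"
    using KZ mult_left_mono[of 1 "C + 1" "128 * Z"] C0 Z(1) by linarith
  have KC: "real (loss_const k) \<ge> 128 * Z * C"
    using KZ Z(1) by (simp add: algebra_simps)
  have g1: "4 * ?t * l \<le> ?d * \<sigma> * n"
  proof -
    have "4 * ?t * l \<le> real (loss_const k) * l" using KZ1 Z lpos by (intro mult_right_mono) auto
    then show ?thesis using h1 by (simp add: l_def n_def)
  qed
  show ?thesis
  proof (cases "\<exists>S\<subseteq>P. card S = k \<and> (\<forall>a\<in>S. \<forall>b\<in>S. a \<noteq> b \<longrightarrow> heavy m a b)")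
    case True
    then obtain S where "S \<subseteq> P" "card S = k" "\<forall>a\<in>S. \<forall>b\<in>S. a \<noteq> b \<longrightarrow> heavy m a b" by blast
    then show ?thesis
      by (intro heavy_clique_gives_subdivision[of S k m]) (auto simp: m_def matching_size_def)
  next
    case False
    then have no_clique: "\<not> (\<exists>S\<subseteq>P. card S = Suc t \<and> (\<forall>a\<in>S. \<forall>b\<in>S. a \<noteq> b \<longrightarrow> heavy m a b))"
      by (simp add: k_def)
    have "\<exists>f :: 'a set \<Rightarrow> nat. \<forall>i<k. D \<le> card {L \<in> {L \<in> \<L>. x \<in> L}. f L = i}" if "x \<in> P" for x
      using exists_balanced_colouring[of "{L \<in> \<L>. x \<in> L}" k D] degree[OF that] finite_lines by auto
    then obtain f :: "'a \<Rightarrow> 'a set \<Rightarrow> nat"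
      where f: "\<And>x i. x \<in> P \<Longrightarrow> i < k \<Longrightarrow> D \<le> card {L \<in> {L \<in> \<L>. x \<in> L}. f x L = i}"
      by metis
    define E where "E i = {(x, L). x \<in> P \<and> L \<in> \<L> \<and> x \<in> L \<and> f x L = i}" for i
    have Esub: "E i \<subseteq> {(p, L). p \<in> P \<and> L \<in> \<L> \<and> p \<in> L}" for i by (auto simp: E_def)
    have Edeg: "?d \<le> real (card {L. (x, L) \<in> E i})" if "x \<in> P" "i < k" for x i
    proof -
      have "{L. (x, L) \<in> E i} = {L \<in> {L \<in> \<L>. x \<in> L}. f x L = i}" using that by (auto simp: E_def)
      then show ?thesis using f[OF that] by simp
    qed
    have step: "\<exists>x\<in>X. ?d ^ 4 * real (card X) ^ 2 / (16 * ?m ^ 2 * ?t ^ 3 * l ^ 2)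
        \<le> real (card {y \<in> X. joined (E i) m x y})"
      if X: "X \<subseteq> P" "\<sigma> * n / 2 \<le> real (card X)" and i: "i < k" for X i
      unfolding l_def
    proof (rule point_joined_to_many)
      have c0: "0 < \<sigma> * n / 2" using \<sigma> npos by simp
      then show "X \<noteq> {}" using X(2) by auto
      have "2 * ?t * l \<le> ?d * (\<sigma> * n / 2)" using g1 by (simp add: mult.assoc)
      also have "\<dots> \<le> ?d * real (card X)" using X(2) by (intro mult_left_mono) auto
      finally show "2 * ?t * real (card \<L>) \<le> ?d * real (card X)" by (simp add: l_def)
      let ?w = "real \<Delta>\<^sub>1 * real \<Delta>\<^sub>2 ^ 2 * l ^ 2"
      have w0: "?w \<ge> 0" by simp
      have "8 * ?t ^ 3 * (2 * ?m + 1) \<le> 8 * ?t ^ 3 * (2 * ?m + ?m)"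
        using m1 t1 by (intro mult_left_mono) auto
      also have "\<dots> = 24 * (?t ^ 3 * ?m)" by simp
      also have "\<dots> \<le> 24 * Z" using Z(2) by simp
      finally have "8 * ?t ^ 3 * (2 * ?m + 1) \<le> 24 * Z" .
      then have "8 * ?t ^ 3 * (2 * ?m + 1) \<le> real (loss_const k) / 4" using KZ1 Z(1) by linarith
      then have "8 * ?t ^ 3 * (2 * ?m + 1) * ?w \<le> real (loss_const k) / 4 * ?w"
        using w0 by (rule mult_right_mono)
      also have "\<dots> \<le> (?d ^ 4 * \<sigma> ^ 2 * n ^ 2) / 4" using h2 by (simp add: l_def n_def)
      also have "\<dots> = ?d ^ 4 * (\<sigma> * n / 2) ^ 2" by (simp add: power_divide power_mult_distrib)
      also have "\<dots> \<le> ?d ^ 4 * real (card X) ^ 2"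
        using X(2) c0 by (intro mult_left_mono power_mono) auto
      finally show "8 * ?t ^ 3 * (2 * ?m + 1) * real \<Delta>\<^sub>1 * real \<Delta>\<^sub>2 ^ 2 * real (card \<L>) ^ 2
        \<le> ?d ^ 4 * real (card X) ^ 2" by (simp add: l_def mult_ac)
    qed (use t mpos D no_clique Esub Edeg X i point_degree line_degree in auto)
    \<comment> \<open>A point is joined to at most \<open>card P\<close> points, which bounds the density from above.\<close>
    have upper: "?d ^ 4 * n \<le> 16 * Z * l ^ 2"
    proof -
      have "\<sigma> * n / 2 \<le> real (card P)" using \<sigma> npos mult_right_mono[of \<sigma> 1 n] by (simp add: n_def)
      then obtain x where "x \<in> P" and x: "?d ^ 4 * n ^ 2 / (16 * ?m ^ 2 * ?t ^ 3 * l ^ 2)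
        \<le> real (card {y \<in> P. joined (E 0) m x y})"
        using step[of P 0] by (auto simp: n_def k_def)
      have "card {y \<in> P. joined (E 0) m x y} \<le> card P" using finite_points by (intro card_mono) auto
      then have "?d ^ 4 * n ^ 2 / (16 * ?m ^ 2 * ?t ^ 3 * l ^ 2) \<le> n" using x by (simp add: n_def)
      then have "?d ^ 4 * n ^ 2 \<le> n * (16 * Z * l ^ 2)"
        using lpos t1 m1 by (simp add: divide_le_eq Z_def mult_ac)
      then have "n * (?d ^ 4 * n) \<le> n * (16 * Z * l ^ 2)" by (simp add: power2_eq_square mult_ac)
      then show ?thesis using npos by simp
    qed
    have small: "C * (real \<Delta>\<^sub>1 * real \<Delta>\<^sub>2 ^ 2) \<le> \<sigma> * n / 2"
    proof -
      let ?w = "real \<Delta>\<^sub>1 * real \<Delta>\<^sub>2 ^ 2"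
      have "128 * Z * C * (?w * l ^ 2) \<le> real (loss_const k) * (?w * l ^ 2)"
        using KC by (intro mult_right_mono) auto
      also have "\<dots> \<le> ?d ^ 4 * \<sigma> ^ 2 * n ^ 2" using h2 by (simp add: l_def n_def)
      also have "\<dots> = (?d ^ 4 * n) * (\<sigma> ^ 2 * n)" by (simp add: power2_eq_square)
      also have "\<dots> \<le> (16 * Z * l ^ 2) * (\<sigma> ^ 2 * n)" using upper \<sigma> npos by (intro mult_right_mono) auto
      finally have "(16 * Z * l ^ 2) * (8 * (C * ?w)) \<le> (16 * Z * l ^ 2) * (\<sigma> ^ 2 * n)" by (simp add: mult_ac)
      moreover have "0 < 16 * Z * l ^ 2" using Z lpos by simp
      ultimately have "8 * (C * ?w) \<le> \<sigma> ^ 2 * n" by (simp only: mult_le_cancel_left_pos)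
      also have "\<dots> \<le> \<sigma> * n" using \<sigma> npos by (intro mult_right_mono) (auto simp: power2_eq_square mult_left_le)
      finally have "8 * (C * ?w) \<le> \<sigma> * n" .
      moreover have "0 \<le> C * ?w" using C0 by simp
      ultimately show ?thesis by linarith
    qed
    define \<eta> where "\<eta> j = \<beta> ^ (2 ^ j - 1)" for j :: nat
    have \<eta>\<sigma>: "\<sigma> \<le> \<eta> j" if "j \<le> k" for j
    proof -
      have "(2::nat) ^ j \<le> 2 ^ k" using that by (intro power_increasing) auto
      then have "(2::nat) ^ j - 1 \<le> 2 ^ k" by linarith
      then show ?thesis unfolding \<sigma>_def \<eta>_def using \<beta> by (intro power_decreasing) auto
    qed
    have \<eta>Suc: "\<eta> (Suc j) = \<beta> * (\<eta> j)\<^sup>2" for j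
    proof -
      have "(1::nat) \<le> 2 ^ j" by simp
      then have "2 ^ Suc j - 1 = Suc (2 * (2 ^ j - 1 :: nat))" unfolding power_Suc by arith
      then show ?thesis by (simp add: \<eta>_def mult.commute flip: power_mult)
    qed
    have "\<exists>x M w X. induced_subdivision P \<L> j x M w \<and> X \<subseteq> P \<and> \<eta> j * n \<le> real (card X) \<and>
        (\<forall>i<j. \<forall>y\<in>X. joined (E i) m (x i) y) \<and>
        (\<forall>a<j. \<forall>b<j. a \<noteq> b \<longrightarrow> \<not> heavy m (x a) (x b))" if "j \<le> k" for j
      using that
    proof (induction j)
      case 0
      show ?case
        by (intro exI[of _ P] exI) (auto simp: induced_subdivision_def \<eta>_def n_def)
    next
      case (Suc j)
      then obtain x M w X where ind: "induced_subdivision P \<L> j x M w" and X: "X \<subseteq> P"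
        and cX: "\<eta> j * n \<le> real (card X)" and jn: "\<And>i y. i < j \<Longrightarrow> y \<in> X \<Longrightarrow> joined (E i) m (x i) y"
        and light: "\<And>a b. a < j \<Longrightarrow> b < j \<Longrightarrow> a \<noteq> b \<Longrightarrow> \<not> heavy m (x a) (x b)"
        by (metis Suc_leD)
      have jk: "j < k" using Suc.prems by simp
      have xP: "x ` {..<j} \<subseteq> P" using ind by (auto simp: induced_subdivision_def)
      have wP: "w a b \<in> P" if "a < j" "b < j" "a \<noteq> b" for a b
        using ind that by (auto simp: induced_subdivision_def)
      note dg = card_danger[where w = w and \<Delta> = \<Delta>\<^sub>2, OF xP light wP line_degree D2]
      define F where "F = (\<Union>z\<in>danger j x w. collinear_with z)"
      have dP: "danger j x w \<subseteq> P"
        using xP wP by (auto simp: danger_def old_points_def)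
      have finF: "finite F" using dg(1) finite_collinear_with by (auto simp: F_def)
      have cF: "real (card F) \<le> \<sigma> * n / 2"
      proof -
        have "card F \<le> (\<Sum>z\<in>danger j x w. card (collinear_with z))"
          unfolding F_def by (rule card_UN_le[OF dg(1)])
        also have "\<dots> \<le> (\<Sum>z\<in>danger j x w. \<Delta>\<^sub>1 * \<Delta>\<^sub>2)"
          using dP by (intro sum_mono card_collinear_with point_degree line_degree) auto
        also have "\<dots> = card (danger j x w) * (\<Delta>\<^sub>1 * \<Delta>\<^sub>2)" by simp
        also have "\<dots> \<le> ((4 * j ^ 4 + 2 * j\<^sup>2 + 2 * m * j\<^sup>2) * \<Delta>\<^sub>2) * (\<Delta>\<^sub>1 * \<Delta>\<^sub>2)"
          using dg(2) by (intro mult_le_mono1)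
        also have "\<dots> \<le> (danger_const k * \<Delta>\<^sub>2) * (\<Delta>\<^sub>1 * \<Delta>\<^sub>2)"
          unfolding danger_const_def m_def using jk
          by (intro mult_le_mono1 add_mono mult_le_mono2 power_mono) auto
        finally have "real (card F) \<le> real ((danger_const k * \<Delta>\<^sub>2) * (\<Delta>\<^sub>1 * \<Delta>\<^sub>2))" by (simp only: of_nat_le_iff)
        also have "\<dots> = C * (real \<Delta>\<^sub>1 * real \<Delta>\<^sub>2 ^ 2)" by (simp add: C_def power2_eq_square)
        finally show ?thesis using small by linarith
      qed
      define Y where "Y = X - F"
      have "card X \<le> card (Y \<union> F)"
        using X finite_points finF by (intro card_mono) (auto simp: Y_def intro: finite_subset)
      then have "real (card X) \<le> real (card Y + card F)"
        using card_Un_le[of Y F] by linarith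
      moreover have "\<sigma> * n \<le> \<eta> j * n" using \<eta>\<sigma>[of j] jk npos by (intro mult_right_mono) auto
      ultimately have cY: "\<eta> j * n / 2 \<le> real (card Y)" and "\<sigma> * n / 2 \<le> real (card Y)"
        using cF cX unfolding of_nat_add by linarith+
      then obtain y where y: "y \<in> Y" and big: "?d ^ 4 * real (card Y) ^ 2 / (16 * ?m ^ 2 * ?t ^ 3 * l ^ 2)
        \<le> real (card {z \<in> Y. joined (E j) m y z})"
        using step[of Y j] X jk by (auto simp: Y_def)
      have yX: "y \<in> X" "y \<in> P" "y \<notin> F" using y X by (auto simp: Y_def)
      have "\<forall>i. \<exists>L q L'. i < j \<longrightarrow> ((x i, L) \<in> E i \<and> (q, L) \<in> E i \<and> (q, L') \<in> E i \<and> (y, L') \<in> E i \<and>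
          y \<notin> L \<and> x i \<notin> L')"
        using jn[OF _ yX(1)] unfolding joined_def by blast
      then obtain L q L' where path: "\<And>i. i < j \<Longrightarrow> (x i, L i) \<in> E i \<and> (q i, L i) \<in> E i \<and>
          (q i, L' i) \<in> E i \<and> (y, L' i) \<in> E i \<and> y \<notin> L i \<and> x i \<notin> L' i" by metis
      have "\<exists>M' w'. induced_subdivision P \<L> (Suc j) (x(j := y)) M' w'"
      proof (rule induced_subdivision_extend[OF ind yX(2)])
        show "y \<notin> collinear_with z" if "z \<in> danger j x w" for z using yX(3) that by (auto simp: F_def)
        show "L i \<in> \<L> \<and> L' i \<in> \<L> \<and> q i \<in> P \<and> x i \<in> L i \<and> q i \<in> L i \<and> q i \<in> L' i \<and>
          y \<in> L' i \<and> y \<notin> L i \<and> x i \<notin> L' i" if "i < j" for i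
          using path[OF that] by (auto simp: E_def)
        show "L' i \<noteq> L' a" if "i < j" "a < j" "i \<noteq> a" for i a
        proof -
          \<comment> \<open>The last lines are distinct since they have different colours at \<open>y\<close>.\<close>
          have "(y, L' i) \<in> E i" "(y, L' a) \<in> E a" using path that(1,2) by blast+
          then have "f y (L' i) = i" "f y (L' a) = a" by (simp_all add: E_def)
          then show ?thesis using that(3) by metis
        qed
      qed
      then obtain M' w' where "induced_subdivision P \<L> (Suc j) (x(j := y)) M' w'" by blast
      moreover have "{z \<in> Y. joined (E j) m y z} \<subseteq> P" using X by (auto simp: Y_def)
      moreover have "\<eta> (Suc j) * n \<le> real (card {z \<in> Y. joined (E j) m y z})"
      proof -
        have "64 * Z * l ^ 2 * \<beta> \<le> real (loss_const k) * l ^ 2 * \<beta>"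
          using KZ1 Z(1) \<beta> by (intro mult_right_mono) auto
        then have "64 * Z * l ^ 2 * \<beta> \<le> ?d ^ 4 * n" using h3 by (simp add: l_def n_def)
        then have "\<beta> \<le> ?d ^ 4 * n / (64 * Z * l ^ 2)"
          using Z lpos by (simp add: le_divide_eq mult_ac)
        then have "\<beta> * ((\<eta> j)\<^sup>2 * n) \<le> ?d ^ 4 * n / (64 * Z * l ^ 2) * ((\<eta> j)\<^sup>2 * n)"
          using npos by (intro mult_right_mono) auto
        also have "\<dots> = ?d ^ 4 * (\<eta> j * n / 2) ^ 2 / (16 * Z * l ^ 2)"
          by (simp add: power2_eq_square field_simps)
        also have "\<dots> \<le> ?d ^ 4 * real (card Y) ^ 2 / (16 * Z * l ^ 2)"
          using cY npos \<beta> Z by (intro divide_right_mono mult_left_mono power_mono) (auto simp: \<eta>_def)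
        also have "\<dots> \<le> real (card {z \<in> Y. joined (E j) m y z})"
          using big by (simp add: Z_def mult_ac)
        finally show ?thesis by (simp add: \<eta>Suc mult_ac)
      qed
      moreover have "joined (E i) m ((x(j := y)) i) z"
        if "i < Suc j" "z \<in> {z \<in> Y. joined (E j) m y z}" for i z
        using that jn[of i z] by (auto simp: Y_def less_Suc_eq)
      moreover have "\<not> heavy m ((x(j := y)) a) ((x(j := y)) b)" if "a < Suc j" "b < Suc j" "a \<noteq> b" for a b
      proof -
        have xy: "\<not> heavy m (x i) y" if "i < j" for i using jn[OF that yX(1)] by (simp add: joined_def)
        then have "\<not> heavy m y (x i)" if "i < j" for i using heavy_sym that by blast
        then show ?thesis using that light xy by (auto simp: less_Suc_eq)
      qed
      ultimately show ?case by blast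
    qed
    from this[of k] show ?thesis by blast
  qed
qed

end

section \<open>Passing to a regular subsystem\<close>

lemma dyadic_class_carries_sum:
  fixes f :: "'a \<Rightarrow> nat"
  assumes "finite A" "0 < l" and lt: "\<And>a. a \<in> A \<Longrightarrow> f a < 2 ^ l"
  obtains j where "sum f A \<le> l * sum f {a \<in> A. 2 ^ j \<le> f a \<and> f a < 2 ^ Suc j}"
proof -
  define C where "C j = {a \<in> A. 2 ^ j \<le> f a \<and> f a < 2 ^ Suc j}" for j
  have "sum f A \<le> (\<Sum>a\<in>A. \<Sum>j<l. if a \<in> C j then f a else 0)"
  proof (rule sum_mono)
    fix a assume a: "a \<in> A"
    show "f a \<le> (\<Sum>j<l. if a \<in> C j then f a else 0)"
    proof (cases "f a = 0")
      case False
      then obtain j where j: "2 ^ j \<le> f a" "f a < 2 ^ (j + 1)"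
        using ex_power_ivl1[of 2 "f a"] by auto
      have "(2::nat) ^ j < 2 ^ l" using j(1) lt[OF a] by linarith
      then have "j < l" by (rule power_less_imp_less_exp[rotated]) simp
      then have "(if a \<in> C j then f a else 0) \<le> (\<Sum>j<l. if a \<in> C j then f a else 0)"
        by (intro member_le_sum) auto
      then show ?thesis using j a by (simp add: C_def)
    qed simp
  qed
  also have "\<dots> = (\<Sum>j<l. \<Sum>a\<in>A. if a \<in> C j then f a else 0)" by (rule sum.swap)
  also have "\<dots> = (\<Sum>j<l. sum f (C j))"
  proof (rule sum.cong)
    fix j
    have "{a \<in> A. a \<in> C j} = C j" by (auto simp: C_def)
    then show "(\<Sum>a\<in>A. if a \<in> C j then f a else 0) = sum f (C j)"
      using sum.inter_filter[OF assms(1), of f "\<lambda>a. a \<in> C j"] by simp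
  qed simp
  finally have total: "sum f A \<le> (\<Sum>j<l. sum f (C j))" .
  show ?thesis
  proof (rule ccontr)
    assume "\<not> thesis"
    then have "l * sum f (C j) < sum f A" for j using that[of j] by (force simp: C_def)
    then have "(\<Sum>j<l. l * sum f (C j)) < (\<Sum>j<l. sum f A)"
      using assms(2) by (intro sum_strict_mono) auto
    then have "l * (\<Sum>j<l. sum f (C j)) < l * sum f A" by (simp add: sum_distrib_left)
    then show False using total by simp
  qed
qed

text \<open>Restrict to the best dyadic class of lines with respect to the number of points, and then to the
best dyadic class of points with respect to the number of remaining lines. The second restriction
only lowers the number of points on a line, so the upper bound \<open>\<Delta>\<close> for it persists, and it exceeds
the new average by a factor \<open>4 * l\<close> at most.\<close>

lemma regular_subsystem:
  fixes P :: "'a set" and \<L> :: "'a set set"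
  assumes fin: "finite P" "finite \<L>" and l: "0 < l" "card P < 2 ^ l" "card \<L> < 2 ^ l"
  obtains P' \<L>' d \<Delta> where "P' \<subseteq> P" "\<L>' \<subseteq> \<L>" "0 < d" "0 < \<Delta>"
    "\<And>p. p \<in> P' \<Longrightarrow> d \<le> card {L \<in> \<L>'. p \<in> L} \<and> card {L \<in> \<L>'. p \<in> L} \<le> 2 * d"
    "\<And>L. L \<in> \<L>' \<Longrightarrow> card (L \<inter> P') \<le> \<Delta>"
    "\<Delta> * card \<L>' \<le> 4 * l * (d * card P')"
    "(\<Sum>L\<in>\<L>. card (L \<inter> P)) \<le> 2 * l\<^sup>2 * (d * card P')"
proof -
  have "card (L \<inter> P) < 2 ^ l" for L
    using card_mono[OF fin(1), of "L \<inter> P"] l(2) by auto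
  then obtain i where i: "(\<Sum>L\<in>\<L>. card (L \<inter> P)) \<le>
      l * (\<Sum>L\<in>{L \<in> \<L>. 2 ^ i \<le> card (L \<inter> P) \<and> card (L \<inter> P) < 2 ^ Suc i}. card (L \<inter> P))"
    using dyadic_class_carries_sum[OF fin(2) l(1), of "\<lambda>L. card (L \<inter> P)"] by blast
  define \<L>' where "\<L>' = {L \<in> \<L>. 2 ^ i \<le> card (L \<inter> P) \<and> card (L \<inter> P) < 2 ^ Suc i}"
  define g where "g p = card {L \<in> \<L>'. p \<in> L}" for p
  have fin': "finite \<L>'" using fin(2) by (simp add: \<L>'_def)
  have "g p < 2 ^ l" for p
  proof -
    have "g p \<le> card \<L>" unfolding g_def using fin(2) by (intro card_mono) (auto simp: \<L>'_def)
    then show ?thesis using l(3) by simp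
  qed
  then obtain j where j: "sum g P \<le> l * sum g {p \<in> P. 2 ^ j \<le> g p \<and> g p < 2 ^ Suc j}"
    using dyadic_class_carries_sum[OF fin(1) l(1), of g] by blast
  define P' where "P' = {p \<in> P. 2 ^ j \<le> g p \<and> g p < 2 ^ Suc j}"
  have e1: "(\<Sum>L\<in>\<L>'. card (L \<inter> P)) = sum g P"
  proof -
    have "(\<Sum>L\<in>\<L>'. card {p \<in> P. p \<in> L}) = (\<Sum>p\<in>P. g p)"
      by (rule sum_multicount_gen) (auto simp: fin fin' g_def)
    then show ?thesis by (simp add: Collect_conj_eq Int_commute)
  qed
  have "sum g P' \<le> (\<Sum>p\<in>P'. 2 * 2 ^ j)" by (intro sum_mono) (auto simp: P'_def)
  then have "l * sum g P' \<le> l * (2 * (2 ^ j * card P'))" by (intro mult_le_mono2) (simp add: mult_ac)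
  then have gP': "sum g P \<le> l * (2 * (2 ^ j * card P'))"
    using j unfolding P'_def[symmetric] by linarith
  have "2 ^ i * card \<L>' = (\<Sum>L\<in>\<L>'. 2 ^ i)" by simp
  also have "\<dots> \<le> (\<Sum>L\<in>\<L>'. card (L \<inter> P))" by (intro sum_mono) (auto simp: \<L>'_def)
  finally have "2 ^ i * card \<L>' \<le> l * (2 * (2 ^ j * card P'))" using gP' e1 by simp
  then have "2 * (2 ^ i * card \<L>') \<le> 2 * (l * (2 * (2 ^ j * card P')))" by (rule mult_le_mono2)
  then have a: "2 ^ Suc i * card \<L>' \<le> 4 * l * (2 ^ j * card P')" by (simp add: mult_ac)
  have "(\<Sum>L\<in>\<L>. card (L \<inter> P)) \<le> l * sum g P" using i e1 by (simp add: \<L>'_def)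
  also have "\<dots> \<le> l * (l * (2 * (2 ^ j * card P')))" using gP' by (rule mult_le_mono2)
  also have "\<dots> = 2 * l\<^sup>2 * (2 ^ j * card P')" by (simp add: power2_eq_square)
  finally have b: "(\<Sum>L\<in>\<L>. card (L \<inter> P)) \<le> 2 * l\<^sup>2 * (2 ^ j * card P')" .
  have c: "card (L \<inter> P') \<le> 2 ^ Suc i" if "L \<in> \<L>'" for L
  proof -
    have "card (L \<inter> P') \<le> card (L \<inter> P)" using fin(1) by (intro card_mono) (auto simp: P'_def)
    then show ?thesis using that by (simp add: \<L>'_def)
  qed
  show ?thesis
  proof (rule that[of P' \<L>' "2 ^ j" "2 ^ Suc i"])
    show "2 ^ j \<le> card {L \<in> \<L>'. p \<in> L} \<and> card {L \<in> \<L>'. p \<in> L} \<le> 2 * 2 ^ j" if "p \<in> P'" for p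
      using that by (auto simp: P'_def g_def)
    show "P' \<subseteq> P" "\<L>' \<subseteq> \<L>" by (auto simp: P'_def \<L>'_def)
    show "2 ^ Suc i * card \<L>' \<le> 4 * l * (2 ^ j * card P')" by (rule a)
    show "(\<Sum>L\<in>\<L>. card (L \<inter> P)) \<le> 2 * l\<^sup>2 * (2 ^ j * card P')" by (rule b)
    show "card (L \<inter> P') \<le> 2 ^ Suc i" if "L \<in> \<L>'" for L by (rule c[OF that])
  qed simp_all
qed

lemma induced_subdivision_mono:
  "induced_subdivision P' \<L>' k x M w \<Longrightarrow> P' \<subseteq> P \<Longrightarrow> \<L>' \<subseteq> \<L> \<Longrightarrow> induced_subdivision P \<L> k x M w"
  unfolding induced_subdivision_def subset_eq by simp

text \<open>Here \<open>r\<close> stands for \<open>n powr (1 / 4)\<close>, and the last hypothesis says that the number of incidences is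
at least \<open>n powr (5 / 4) / T\<close>. The regular subsystem satisfies \<open>d * card P' \<ge> r ^ 5 / T ^ 3\<close>, hence
\<open>d ^ 4 * card P' \<ge> (card \<L>')\<^sup>2 / T ^ 12\<close>, and \<open>\<beta> = 1 / T ^ 13\<close> leaves a factor \<open>T\<close> for the
constants. So \<open>\<sigma> = 1 / T ^ s\<close>, and the other hypotheses of \<open>dense_regular_gives_subdivision\<close> hold
because \<open>r\<close> is at least \<open>T ^ (6 + 2 * s)\<close>.\<close>

lemma (in linear_space) many_incidences_give_subdivision:
  fixes t l s :: nat and T r :: real
  defines "k \<equiv> Suc t"
  defines "s \<equiv> 13 * 2 ^ k"
  assumes t: "0 < t" and l: "0 < l" "card P < 2 ^ l" "card \<L> < 2 ^ l"
    and T: "4 * real l \<le> T" "32 * real k ^ 4 * real (loss_const k) \<le> T"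
    and r: "T ^ (6 + 2 * s) \<le> r" "real (card P) \<le> r ^ 4" "real (card \<L>) \<le> r ^ 4"
    and many: "r ^ 5 \<le> real (\<Sum>L\<in>\<L>. card (L \<inter> P)) * T"
  shows "\<exists>x M w. induced_subdivision P \<L> k x M w"
proof -
  obtain P' \<L>' d \<Delta> where sub: "P' \<subseteq> P" "\<L>' \<subseteq> \<L>" and d: "0 < d" and \<Delta>: "0 < \<Delta>"
    and pdeg: "\<And>p. p \<in> P' \<Longrightarrow> d \<le> card {L \<in> \<L>'. p \<in> L} \<and> card {L \<in> \<L>'. p \<in> L} \<le> 2 * d"
    and ldeg: "\<And>L. L \<in> \<L>' \<Longrightarrow> card (L \<inter> P') \<le> \<Delta>"
    and lines: "\<Delta> * card \<L>' \<le> 4 * l * (d * card P')"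
    and inc: "(\<Sum>L\<in>\<L>. card (L \<inter> P)) \<le> 2 * l\<^sup>2 * (d * card P')"
    using regular_subsystem[OF finite_points finite_lines l] by blast
  have fin': "finite P'" "finite \<L>'" using sub finite_points finite_lines finite_subset by blast+
  define D where "D = d div k"
  define C where "C = real (loss_const k)"
  define n1 where "n1 = real (card P')"
  define n2 where "n2 = real (card \<L>')"
  let ?d = "real d" and ?k = "real k"
  have k1: "?k \<ge> 1" by (simp add: k_def)
  have C1: "C \<ge> 1"
  proof -
    have "loss_const k \<ge> 1" by (simp add: loss_const_def k_def matching_size_def Suc_le_eq)
    then show ?thesis by (simp add: C_def)
  qed
  have k4: "?k ^ 4 \<ge> 1" "?k \<le> ?k ^ 4" using k1 by (auto intro: one_le_power self_le_power)
  have TkC: "32 * (?k ^ 4 * C) \<le> T" using T(2) by (simp add: C_def)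
  have kC: "?k ^ 4 \<le> ?k ^ 4 * C" "C \<le> ?k ^ 4 * C" "?k * C \<le> ?k ^ 4 * C"
    using k4 C1 k1 by (simp_all add: mult_le_cancel_left1 mult_le_cancel_right1)
  have T1: "T \<ge> 1" using TkC kC C1 by linarith
  have Tp: "T ^ i > 0" for i using T1 by simp
  have Tmono: "T ^ i \<le> T ^ j" if "i \<le> j" for i j using T1 that by (intro power_increasing)
  have r1: "r \<ge> 1" using r(1) Tmono[of 0 "6 + 2 * s"] by simp
  have n1le: "n1 \<le> r ^ 4"
    using card_mono[OF finite_points sub(1)] r(2) unfolding n1_def by linarith
  have n2le: "n2 \<le> r ^ 4"
    using card_mono[OF finite_lines sub(2)] r(3) unfolding n2_def by linarith
  have n0: "n1 \<ge> 0" "n2 \<ge> 0" by (auto simp: n1_def n2_def)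
  \<comment> \<open>The two restrictions to dyadic classes cost a factor of at most \<open>T\<^sup>2\<close>.\<close>
  have A: "r ^ 5 \<le> T ^ 3 * (?d * n1)"
  proof -
    have "real (\<Sum>L\<in>\<L>. card (L \<inter> P)) \<le> real (2 * l\<^sup>2 * (d * card P'))" using inc by (simp only: of_nat_le_iff)
    also have "\<dots> = 2 * real l ^ 2 * (?d * n1)" by (simp add: n1_def)
    also have "2 * real l ^ 2 \<le> (4 * real l) ^ 2" by (simp add: power_mult_distrib)
    also have "\<dots> \<le> T ^ 2" using T(1) by (intro power_mono) auto
    finally have "real (\<Sum>L\<in>\<L>. card (L \<inter> P)) \<le> T ^ 2 * (?d * n1)"
      using n0 by (simp add: mult_right_mono)
    then have "real (\<Sum>L\<in>\<L>. card (L \<inter> P)) * T \<le> T ^ 2 * (?d * n1) * T" using T1 by (intro mult_right_mono) auto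
    then show ?thesis using many by (simp add: eval_nat_numeral mult_ac)
  qed
  have n1pos: "n1 > 0"
  proof (rule ccontr)
    assume "\<not> n1 > 0"
    then have "r ^ 5 \<le> 0" using A n0 by simp
    then show False using r1 by (smt (verit) one_le_power)
  qed
  have B: "r \<le> T ^ 3 * ?d"
  proof -
    have "r * r ^ 4 \<le> T ^ 3 * (?d * n1)" using A by (simp add: eval_nat_numeral)
    also have "\<dots> \<le> T ^ 3 * (?d * r ^ 4)" using n1le Tp[of 3] by (intro mult_left_mono) auto
    finally have "r * r ^ 4 \<le> (T ^ 3 * ?d) * r ^ 4" by (simp add: mult_ac)
    then show ?thesis using r1 by (simp add: mult_le_cancel_right)
  qed
  have dbig: "T ^ (3 + 2 * s) \<le> ?d"
  proof -
    have "T ^ 3 * T ^ (3 + 2 * s) = T ^ (6 + 2 * s)" by (simp flip: power_add)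
    also have "\<dots> \<le> T ^ 3 * ?d" using r(1) B by linarith
    finally show ?thesis using Tp[of 3] by (simp only: mult_le_cancel_left_pos)
  qed
  have "?k \<le> ?d"
  proof -
    have "?k \<le> T" using k4 kC(1) TkC by linarith
    then have "?k \<le> T ^ 1" by simp
    then show ?thesis using dbig Tmono[of 1 "3 + 2 * s"] by linarith
  qed
  then have "k \<le> d" by simp
  then have Dpos: "0 < D" by (simp add: D_def div_greater_zero_iff k_def)
  have kD: "k * D \<le> d" by (simp add: D_def)
  have dD: "?d \<le> 2 * ?k * real D"
  proof -
    have "d mod k < k" by (simp add: k_def)
    moreover have "d = k * D + d mod k" unfolding D_def by (rule mult_div_mod_eq[symmetric])
    moreover have "k * 1 \<le> k * D" using Dpos by (intro mult_le_mono2) simp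
    ultimately have "d \<le> 2 * (k * D)" by linarith
    then have "real d \<le> real (2 * (k * D))" by (simp only: of_nat_le_iff)
    then show ?thesis by simp
  qed
  have dD4: "?d ^ 4 \<le> 16 * ?k ^ 4 * real D ^ 4"
    using power_mono[OF dD, of 4] by (simp add: power_mult_distrib)
  define \<beta> where "\<beta> = 1 / T ^ 13"
  have \<beta>: "0 < \<beta>" "\<beta> \<le> 1" using Tp[of 13] Tmono[of 0 13] by (auto simp: \<beta>_def)
  have \<sigma>: "\<beta> ^ (2 ^ k) = 1 / T ^ s" by (simp add: \<beta>_def s_def power_one_over flip: power_mult)
  interpret S: linear_space P' \<L>'
    using fin' sub unique_line by unfold_locales blast+
  have "\<exists>x M w. induced_subdivision P' \<L>' (Suc t) x M w"
  proof (rule S.dense_regular_gives_subdivision[where D = D and \<Delta>\<^sub>1 = "2 * d" and \<Delta>\<^sub>2 = \<Delta> and \<beta> = \<beta>])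
    show "P' \<noteq> {}" using n1pos by (auto simp: n1_def)
    show "Suc t * D \<le> card {L \<in> \<L>'. x \<in> L}" if "x \<in> P'" for x
      using pdeg[OF that] kD by (simp add: k_def)
    show "real (loss_const (Suc t)) * real (card \<L>') \<le> real D * \<beta> ^ (2 ^ Suc t) * real (card P')"
    proof -
      have "T ^ 3 * T ^ s * (2 * (?k * C) * n2) \<le> T ^ 3 * T ^ s * (T * n2)"
      proof -
        have "2 * (?k * C) \<le> T" using TkC kC C1 by linarith
        moreover have "0 \<le> T ^ 3 * T ^ s" using T1 by simp
        ultimately show ?thesis using n0 by (intro mult_left_mono mult_right_mono) auto
      qed
      also have "\<dots> \<le> T ^ 3 * T ^ s * (T * r ^ 4)"
        using n2le T1 by (intro mult_left_mono) auto
      also have "\<dots> = T ^ (4 + s) * r ^ 4" by (simp add: power_add eval_nat_numeral)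
      also have "\<dots> \<le> r * r ^ 4"
        using r(1) Tmono[of "4 + s" "6 + 2 * s"] r1 by (intro mult_right_mono) auto
      also have "\<dots> = r ^ 5" by (simp add: eval_nat_numeral)
      also have "\<dots> \<le> T ^ 3 * (2 * ?k * real D * n1)"
        using A mult_left_mono[OF mult_right_mono[OF dD n0(1)], of "T ^ 3"] Tp[of 3] by linarith
      finally have "(2 * ?k * T ^ 3) * (T ^ s * (C * n2)) \<le> (2 * ?k * T ^ 3) * (real D * n1)"
        by (simp add: mult_ac)
      moreover have "0 < 2 * ?k * T ^ 3" using k1 Tp[of 3] by simp
      ultimately have "T ^ s * (C * n2) \<le> real D * n1" by (simp only: mult_le_cancel_left_pos)
      then have "C * n2 \<le> real D * n1 / T ^ s" using Tp[of s] by (simp add: le_divide_eq mult_ac)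
      then show ?thesis using \<sigma> by (simp add: C_def n1_def n2_def k_def)
    qed
    show "real (loss_const (Suc t)) * (real (2 * d) * real \<Delta> ^ 2 * real (card \<L>') ^ 2)
        \<le> real D ^ 4 * (\<beta> ^ (2 ^ Suc t)) ^ 2 * real (card P') ^ 2"
    proof -
      have "real (\<Delta> * card \<L>') \<le> real (4 * l * (d * card P'))" using lines by (simp only: of_nat_le_iff)
      then have "real \<Delta> * n2 \<le> 4 * real l * (?d * n1)" by (simp add: n1_def n2_def)
      also have "\<dots> \<le> T * (?d * n1)" using T(1) n0 by (intro mult_right_mono) auto
      finally have "(real \<Delta> * n2) ^ 2 \<le> (T * (?d * n1)) ^ 2" using n0 by (intro power_mono) auto
      then have "32 * ?k ^ 4 * T ^ (2 * s) * (C * (?d * (real \<Delta> * n2) ^ 2)) \<le>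
          32 * ?k ^ 4 * T ^ (2 * s) * (C * (?d * (T * (?d * n1)) ^ 2))"
        using C1 Tp by (intro mult_left_mono) auto
      also have "\<dots> = (32 * (?k ^ 4 * C)) * (T ^ (2 * s) * T ^ 2 * (?d ^ 3 * n1 ^ 2))"
        by (simp add: power_mult_distrib eval_nat_numeral mult_ac)
      also have "\<dots> \<le> T * (T ^ (2 * s) * T ^ 2 * (?d ^ 3 * n1 ^ 2))"
        using TkC Tp by (intro mult_right_mono) auto
      also have "\<dots> = T ^ (3 + 2 * s) * (?d ^ 3 * n1 ^ 2)" by (simp add: power_add eval_nat_numeral)
      also have "\<dots> \<le> ?d * (?d ^ 3 * n1 ^ 2)" using dbig by (intro mult_right_mono) auto
      also have "\<dots> = ?d ^ 4 * n1 ^ 2" by (simp add: eval_nat_numeral)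
      also have "\<dots> \<le> 16 * ?k ^ 4 * real D ^ 4 * n1 ^ 2" using dD4 by (intro mult_right_mono) auto
      finally have "(16 * ?k ^ 4) * (T ^ (2 * s) * (C * (2 * ?d * (real \<Delta> * n2) ^ 2))) \<le> (16 * ?k ^ 4) * (real D ^ 4 * n1 ^ 2)"
        by (simp add: mult_ac)
      moreover have "0 < 16 * ?k ^ 4" using k4(1) by linarith
      ultimately have "T ^ (2 * s) * (C * (2 * ?d * (real \<Delta> * n2) ^ 2)) \<le> real D ^ 4 * n1 ^ 2"
        by (simp only: mult_le_cancel_left_pos)
      then have "C * (2 * ?d * (real \<Delta> * n2) ^ 2) \<le> real D ^ 4 * n1 ^ 2 / T ^ (2 * s)"
        using Tp[of "2 * s"] by (simp add: le_divide_eq mult_ac)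
      moreover have "(\<beta> ^ (2 ^ Suc t)) ^ 2 = 1 / T ^ (2 * s)"
        using \<sigma> by (simp add: k_def power_one_over mult.commute flip: power_mult)
      ultimately show ?thesis
        by (simp add: C_def n1_def n2_def k_def power_mult_distrib mult_ac)
    qed
    show "real (loss_const (Suc t)) * real (card \<L>') ^ 2 * \<beta> \<le> real D ^ 4 * real (card P')"
    proof -
      have "r ^ 12 * r ^ 8 = (r ^ 5) ^ 4" by (simp flip: power_mult power_add)
      also have "\<dots> \<le> (T ^ 3 * (?d * n1)) ^ 4" using A r1 by (intro power_mono) auto
      also have "\<dots> = T ^ 12 * (?d ^ 4 * n1) * n1 ^ 3"
        by (simp add: power_mult_distrib eval_nat_numeral mult_ac)
      also have "\<dots> \<le> T ^ 12 * (?d ^ 4 * n1) * (r ^ 4) ^ 3"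
        using n1le n0 Tp by (intro mult_left_mono power_mono) auto
      also have "\<dots> = r ^ 12 * (T ^ 12 * (?d ^ 4 * n1))" by (simp add: mult_ac flip: power_mult)
      finally have "r ^ 12 * r ^ 8 \<le> r ^ 12 * (T ^ 12 * (?d ^ 4 * n1))" .
      moreover have "0 < r ^ 12" using r1 by simp
      ultimately have "r ^ 8 \<le> T ^ 12 * (?d ^ 4 * n1)" by (simp only: mult_le_cancel_left_pos)
      moreover have "n2 ^ 2 \<le> (r ^ 4) ^ 2" using n2le n0 by (intro power_mono) auto
      ultimately have "n2 ^ 2 \<le> T ^ 12 * (?d ^ 4 * n1)" by (simp flip: power_mult)
      also have "\<dots> \<le> T ^ 12 * ((16 * ?k ^ 4 * real D ^ 4) * n1)"
        using dD4 n0 Tp[of 12] by (intro mult_left_mono mult_right_mono) auto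
      finally have "C * n2 ^ 2 \<le> C * (T ^ 12 * ((16 * ?k ^ 4 * real D ^ 4) * n1))"
        using C1 by (intro mult_left_mono) auto
      also have "\<dots> = (16 * (?k ^ 4 * C)) * (T ^ 12 * (real D ^ 4 * n1))" by (simp add: mult_ac)
      also have "\<dots> \<le> T * (T ^ 12 * (real D ^ 4 * n1))"
        using TkC kC C1 n0 Tp[of 12] by (intro mult_right_mono) auto
      also have "\<dots> = (real D ^ 4 * n1) * T ^ 13" by (simp add: eval_nat_numeral)
      finally have "C * n2 ^ 2 * \<beta> \<le> real D ^ 4 * n1"
        using Tp[of 13] by (simp add: \<beta>_def divide_le_eq)
      then show ?thesis by (simp add: C_def n1_def n2_def k_def)
    qed
  qed (use t Dpos \<Delta> \<beta> pdeg ldeg in auto)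
  then show ?thesis using induced_subdivision_mono[OF _ sub] unfolding k_def by blast
qed

section \<open>Points and lines in the plane\<close>

lemma card_increasing_pairs: "card {(i, j). i < j \<and> j < k} = (k :: nat) choose 2"
proof -
  have "{(i, j). i < j \<and> j < k} = prod.swap ` Sigma {..<k} (\<lambda>j. {..<j})" by (auto simp: image_iff)
  then have "card {(i, j). i < j \<and> j < k} = card (Sigma {..<k} (\<lambda>j. {..<j}))" by (simp add: card_image)
  also have "\<dots> = (\<Sum>j<k. j)" by (simp add: card_SigmaI)
  also have "\<dots> = k choose 2"
    by (induction k) (simp_all add: numeral_2_eq_2)
  finally show ?thesis .
qed

lemma card_distinct_pairs: "card {(i, j). i < k \<and> j < k \<and> i \<noteq> j} = 2 * ((k :: nat) choose 2)"
proof -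
  let ?I = "{(i, j). i < j \<and> j < k}"
  have fin: "finite ?I" by (rule finite_subset[of _ "{..<k} \<times> {..<k}"]) auto
  have "{(i, j). i < k \<and> j < k \<and> i \<noteq> j} = ?I \<union> prod.swap ` ?I" by (auto simp: image_iff)
  moreover have "?I \<inter> prod.swap ` ?I = {}" by auto
  ultimately have "card {(i, j). i < k \<and> j < k \<and> i \<noteq> j} = card ?I + card (prod.swap ` ?I)"
    using fin by (simp add: card_Un_disjoint)
  also have "card (prod.swap ` ?I) = card ?I" by (rule card_image) simp
  finally show ?thesis by (simp add: card_increasing_pairs)
qed

lemma induced_subdivision_imp_contains_subdivided_clique:
  assumes conf: "configuration P \<L>" and ind: "induced_subdivision P \<L> k x M w"
  shows "contains_subdivided_clique k P \<L>"
proof -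
  have xP: "x i \<in> P" if "i < k" for i using ind that by (simp add: induced_subdivision_def)
  have M: "M a b \<in> \<L>" "w a b \<in> P" "w a b = w b a" if "a < k" "b < k" "a \<noteq> b" for a b
    using ind that unfolding induced_subdivision_def by metis+
  have xM: "x l \<in> M a b \<longleftrightarrow> l = a" if "a < k" "b < k" "a \<noteq> b" "l < k" for a b l
    using ind that unfolding induced_subdivision_def by metis
  have wM: "w c d \<in> M a b \<longleftrightarrow> {c, d} = {a, b}"
    if "a < k" "b < k" "a \<noteq> b" "c < k" "d < k" "c \<noteq> d" for a b c d
    using ind that by (simp add: induced_subdivision_def)
  have wx: "w a b \<noteq> x l" if "a < k" "b < k" "a \<noteq> b" "l < k" for a b l
  proof
    assume eq: "w a b = x l"
    have "w a b \<in> M a b" "w a b \<in> M b a" using wM that by (auto simp: insert_commute)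
    then show False using eq xM[of a b l] xM[of b a l] that by simp
  qed
  have xinj: "x a \<noteq> x b" if "a < k" "b < k" "a \<noteq> b" for a b
    using xM[of a b a] xM[of a b b] that by auto
  define I where "I = {(i, j). i < j \<and> j < k}"
  define J where "J = {(i, j). i < k \<and> j < k \<and> i \<noteq> j}"
  define B where "B = x ` {..<k}"
  define W where "W = (\<lambda>(i, j). w i j) ` I"
  define \<L>\<^sub>0 where "\<L>\<^sub>0 = (\<lambda>(i, j). M i j) ` J"
  have W_mem: "w i j \<in> W" if "i < k" "j < k" "i \<noteq> j" for i j
  proof (cases "i < j")
    case True
    then show ?thesis using that by (auto simp: W_def I_def)
  next
    case False
    then have "w j i \<in> W" using that by (auto simp: W_def I_def)
    then show ?thesis using M(3)[OF that] by simp
  qed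
  have W_elim: "\<exists>i j. i < k \<and> j < k \<and> i \<noteq> j \<and> v = w i j" if "v \<in> W" for v
  proof -
    obtain i j where "i < j" "j < k" "v = w i j" using \<open>v \<in> W\<close> by (auto simp: W_def I_def)
    then show ?thesis by (intro exI[of _ i] exI[of _ j]) auto
  qed
  have L_mem: "M i j \<in> \<L>\<^sub>0" if "i < k" "j < k" "i \<noteq> j" for i j
    using that by (auto simp: \<L>\<^sub>0_def J_def)
  have L_elim: "\<exists>i j. i < k \<and> j < k \<and> i \<noteq> j \<and> L = M i j" if "L \<in> \<L>\<^sub>0" for L
  proof -
    obtain i j where "i < k" "j < k" "i \<noteq> j" "L = M i j"
      using \<open>L \<in> \<L>\<^sub>0\<close> by (auto simp: \<L>\<^sub>0_def J_def)
    then show ?thesis by blast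
  qed
  have finJ: "finite J" unfolding J_def by (rule finite_subset[of _ "{..<k} \<times> {..<k}"]) auto
  have finI: "finite I" unfolding I_def by (rule finite_subset[of _ "{..<k} \<times> {..<k}"]) auto
  have BP: "B \<subseteq> P" using xP by (auto simp: B_def)
  have WP: "W \<subseteq> P" using W_elim M(2) by fastforce
  have LL: "\<L>\<^sub>0 \<subseteq> \<L>" using L_elim M(1) by fastforce
  have wM_inj: "{a, b} = {c, d}" if "a < k" "b < k" "a \<noteq> b" "c < k" "d < k" "c \<noteq> d" "w a b = w c d" for a b c d
    using wM[OF that(1-3,1-3)] wM[OF that(1-3,4-6)] that(7) wM[OF that(4-6) that(4-6)] by auto
  have cardW: "card W = k choose 2"
  proof -
    have "inj_on (\<lambda>(i, j). w i j) I"
    proof (rule inj_onI)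
      fix p q assume p: "p \<in> I" "q \<in> I" and eq: "(case p of (i, j) \<Rightarrow> w i j) = (case q of (i, j) \<Rightarrow> w i j)"
      obtain a b c d where pq: "p = (a, b)" "q = (c, d)" by (cases p, cases q)
      have "a < b" "b < k" "c < d" "d < k" using p pq by (auto simp: I_def)
      moreover from this have "{a, b} = {c, d}" using wM_inj[of a b c d] eq pq by auto
      ultimately show "p = q" using pq by (auto simp: doubleton_eq_iff)
    qed
    then show ?thesis unfolding W_def by (simp add: card_image I_def card_increasing_pairs)
  qed
  have cardL: "card \<L>\<^sub>0 = 2 * (k choose 2)"
  proof -
    have "inj_on (\<lambda>(i, j). M i j) J"
    proof (rule inj_onI)
      fix p q assume p: "p \<in> J" "q \<in> J" and eq: "(case p of (i, j) \<Rightarrow> M i j) = (case q of (i, j) \<Rightarrow> M i j)"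
      obtain a b c d where pq: "p = (a, b)" "q = (c, d)" by (cases p, cases q)
      have ab: "a < k" "b < k" "a \<noteq> b" and cd: "c < k" "d < k" "c \<noteq> d" using p pq by (auto simp: J_def)
      have M_eq: "M a b = M c d" using eq pq by simp
      have "a = c" using xM[OF ab ab(1)] xM[OF cd ab(1)] M_eq by simp
      moreover have "{a, b} = {c, d}" using wM[OF ab ab] wM[OF cd ab] M_eq by simp
      ultimately show "p = q" using pq by (auto simp: doubleton_eq_iff)
    qed
    then show ?thesis unfolding \<L>\<^sub>0_def by (simp add: card_image J_def card_distinct_pairs)
  qed
  have cardB: "card B = k"
  proof -
    have "inj_on x {..<k}" using xinj by (auto simp: inj_on_def)
    then show ?thesis by (simp add: B_def card_image)
  qed
  have "subdivided_clique k (B \<union> W) \<L>\<^sub>0"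
    unfolding subdivided_clique_def
  proof (rule conjI[OF _ conjI[OF _ exI[of _ B, OF exI[of _ W]]]]; (intro conjI ballI impI refl)?)
    show "configuration (B \<union> W) \<L>\<^sub>0"
      using conf LL finI finJ by (auto simp: configuration_def B_def W_def \<L>\<^sub>0_def)
    show "card \<L>\<^sub>0 = 2 * (k choose 2)" "card B = k" "card W = k choose 2" by (fact cardL cardB cardW)+
    show "B \<inter> W = {}"
    proof (rule equals0I)
      fix v assume "v \<in> B \<inter> W"
      then obtain l where "l < k" "v = x l" "v \<in> W" by (auto simp: B_def)
      then show False using W_elim wx by metis
    qed
  next
    fix b b' assume "b \<in> B" "b' \<in> B" "b \<noteq> b'"
    then obtain i j where ij: "b = x i" "b' = x j" "i < k" "j < k" "i \<noteq> j" by (auto simp: B_def)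
    show "\<exists>L\<in>\<L>\<^sub>0. \<exists>L'\<in>\<L>\<^sub>0. L \<noteq> L' \<and> b \<in> L \<and> b' \<in> L' \<and> (\<exists>w\<in>W. w \<in> L \<inter> L')"
    proof (intro bexI conjI)
      show "M i j \<noteq> M j i" using xM[of i j i] xM[of j i i] ij by auto
      show "b \<in> M i j" "b' \<in> M j i" using xM[of i j i] xM[of j i j] ij by auto
      show "w i j \<in> M i j \<inter> M j i" using wM ij by (auto simp: insert_commute)
    qed (use L_mem W_mem ij in auto)
  next
    fix v assume "v \<in> W"
    then obtain i j where ij: "i < k" "j < k" "i \<noteq> j" "v = w i j" using W_elim by blast
    have "{L \<in> \<L>\<^sub>0. v \<in> L} = {M i j, M j i}"
    proof
      show "{L \<in> \<L>\<^sub>0. v \<in> L} \<subseteq> {M i j, M j i}"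
      proof
        fix L assume "L \<in> {L \<in> \<L>\<^sub>0. v \<in> L}"
        then obtain a b where ab: "a < k" "b < k" "a \<noteq> b" "L = M a b" "v \<in> M a b" using L_elim by blast
        then have "{i, j} = {a, b}" using wM[OF ab(1-3) ij(1-3)] ij(4) by simp
        then show "L \<in> {M i j, M j i}" using ab(4) by (auto simp: doubleton_eq_iff)
      qed
      show "{M i j, M j i} \<subseteq> {L \<in> \<L>\<^sub>0. v \<in> L}"
        using L_mem ij wM[of i j i j] wM[of j i i j] by (auto simp: insert_commute)
    qed
    moreover have "M i j \<noteq> M j i" using xM[of i j i] xM[of j i i] ij by auto
    ultimately show "card {L \<in> \<L>\<^sub>0. v \<in> L} = 2" by simp
  next
    fix L assume "L \<in> \<L>\<^sub>0"
    then obtain i j where ij: "i < k" "j < k" "i \<noteq> j" "L = M i j" using L_elim by blast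
    have "L \<inter> B = {x i}" using xM[OF ij(1-3)] ij by (auto simp: B_def)
    then show "card (L \<inter> B) = 1" by simp
    have "L \<inter> W = {w i j}"
    proof
      show "L \<inter> W \<subseteq> {w i j}"
      proof
        fix v assume v: "v \<in> L \<inter> W"
        then obtain a b where ab: "a < k" "b < k" "a \<noteq> b" "v = w a b" using W_elim by blast
        then have "{a, b} = {i, j}" using wM[OF ij(1-3) ab(1-3)] v ij(4) by simp
        then show "v \<in> {w i j}" using ab(4) M(3)[OF ij(1-3)] by (auto simp: doubleton_eq_iff)
      qed
      show "{w i j} \<subseteq> L \<inter> W" using wM[OF ij(1-3) ij(1-3)] W_mem[OF ij(1-3)] ij(4) by simp
    qed
    then show "card (L \<inter> W) = 1" by simp
  qed
  moreover have "isomorphic_configurations (B \<union> W) \<L>\<^sub>0 (B \<union> W) \<L>\<^sub>0"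
    unfolding isomorphic_configurations_def by (intro exI[of _ id]) auto
  ultimately show ?thesis
    unfolding contains_subdivided_clique_def using BP WP LL by blast
qed

lemma lines_through_two_points_equal:
  assumes "is_line L" "is_line L'" "p \<noteq> q" "p \<in> L" "q \<in> L" "p \<in> L'" "q \<in> L'"
  shows "L = L'"
proof -
  have "affine hull {p, q} = K" if "is_line K" "p \<in> K" "q \<in> K" for K
  proof (rule affine_dim_equal)
    show "affine hull {p, q} \<subseteq> K" using that by (intro hull_minimal) (auto simp: is_line_def)
    show "aff_dim (affine hull {p, q}) = aff_dim K"
      using that assms(3) by (simp add: is_line_def aff_dim_2)
  qed (use that in \<open>auto simp: is_line_def\<close>)
  then show ?thesis using assms by blast
qed

lemma card_incidences: 
  assumes "finite P" "finite \<L>"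
  shows "card (incidences P \<L>) = (\<Sum>L\<in>\<L>. card (L \<inter> P))"
proof -
  have "incidences P \<L> = prod.swap ` Sigma \<L> (\<lambda>L. L \<inter> P)" by (auto simp: incidences_def image_iff)
  then have "card (incidences P \<L>) = card (Sigma \<L> (\<lambda>L. L \<inter> P))" by (simp add: card_image)
  then show ?thesis using assms by (simp add: card_SigmaI)
qed

text \<open>For \<open>n\<close> below the bound from which \<open>n powr \<delta>\<close> exceeds the constants and the logarithm, the trivial
bound \<open>n\<^sup>2\<close> on the number of incidences is absorbed by \<open>c\<close>.\<close>

theorem corollary5:
  fixes k :: nat
  assumes "k \<ge> 3"
  shows "\<exists>c \<delta> :: real. c > 0 \<and> \<delta> > 0 \<and>
    (\<forall>(n :: nat) P \<L>. configuration P \<L> \<and> card P = n \<and> card \<L> = n \<and>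
        \<not> contains_subdivided_clique k P \<L> \<longrightarrow>
      real (card (incidences P \<L>)) \<le> c * real n powr (5 / 4 - \<delta>))"
proof -
  obtain t where t: "k = Suc t" "0 < t" using assms by (cases k) auto
  \<comment> \<open>The value of \<open>\<delta>\<close> makes \<open>T ^ (6 + 2 * s) = n powr (1 / 4)\<close> for \<open>T = n powr \<delta>\<close>.\<close>
  define s :: nat where "s = 13 * 2 ^ k"
  define K where "K = 32 * real k ^ 4 * real (loss_const k)"
  define \<delta> :: real where "\<delta> = 1 / (4 * real (6 + 2 * s))"
  have \<delta>: "0 < \<delta>" "\<delta> \<le> 1" by (auto simp: \<delta>_def divide_le_eq)
  have "eventually (\<lambda>n :: real. 4 * (log 2 n + 1) \<le> n powr \<delta> \<and> K \<le> n powr \<delta>) at_top"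
  proof (rule eventually_conj)
    show "eventually (\<lambda>n :: real. 4 * (log 2 n + 1) \<le> n powr \<delta>) at_top" using \<delta>(1) by real_asymp
    show "eventually (\<lambda>n :: real. K \<le> n powr \<delta>) at_top" using \<delta>(1) by real_asymp
  qed
  then obtain N :: real where N: "\<And>n. N \<le> n \<Longrightarrow> 4 * (log 2 n + 1) \<le> n powr \<delta> \<and> K \<le> n powr \<delta>"
    unfolding eventually_at_top_linorder by blast
  define c where "c = 1 + N\<^sup>2"
  have c1: "1 \<le> c" by (simp add: c_def)
  have "real (card (incidences P \<L>)) \<le> c * real n powr (5 / 4 - \<delta>)"
    if conf: "configuration P \<L>" and cP: "card P = n" and cL: "card \<L> = n"
      and no: "\<not> contains_subdivided_clique k P \<L>" for n P \<L>
  proof (rule ccontr)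
    assume "\<not> ?thesis"
    then have many: "c * real n powr (5 / 4 - \<delta>) < real (card (incidences P \<L>))" by simp
    have fin: "finite P" "finite \<L>" using conf by (auto simp: configuration_def)
    have le2: "card (incidences P \<L>) \<le> n * n"
      using card_mono[of "P \<times> \<L>" "incidences P \<L>"] fin cP cL
      by (auto simp: incidences_def card_cartesian_product)
    have npos: "0 < n"
    proof (rule ccontr)
      assume "\<not> 0 < n"
      then show False using many le2 by simp
    qed
    have pow1: "1 \<le> real n powr (5 / 4 - \<delta>)" using npos \<delta> by (intro ge_one_powr_ge_zero) auto
    have nN: "N \<le> real n"
    proof (rule ccontr)
      assume "\<not> N \<le> real n"
      then have "real n * real n \<le> N * N" by (intro mult_mono) auto
      then have "real (card (incidences P \<L>)) \<le> N\<^sup>2"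
        using le2 by (metis of_nat_le_iff of_nat_mult order_trans power2_eq_square)
      also have "\<dots> \<le> c * 1" by (simp add: c_def)
      also have "\<dots> \<le> c * real n powr (5 / 4 - \<delta>)" using c1 pow1 by (intro mult_left_mono) auto
      finally show False using many by simp
    qed
    define T where "T = real n powr \<delta>"
    define r where "r = real n powr (1 / 4)"
    define l where "l = nat \<lfloor>log 2 (real n)\<rfloor> + 1"
    have rp: "r ^ i = real n powr (real i / 4)" for i
      using npos by (simp add: r_def powr_powr flip: powr_realpow)
    interpret linear_space P \<L>
    proof
      show "finite P" "finite \<L>" by (fact fin)+
      show "L = L'" if "p \<in> P" "q \<in> P" "p \<noteq> q" "L \<in> \<L>" "L' \<in> \<L>" "p \<in> L" "q \<in> L" "p \<in> L'" "q \<in> L'"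
        for p q L L'
        using lines_through_two_points_equal[of L L' p q] conf that by (auto simp: configuration_def)
    qed
    have log0: "0 \<le> log 2 (real n)" using npos by simp
    have "n < 2 ^ l"
    proof -
      have "real n = 2 powr log 2 (real n)" using npos by simp
      also have "\<dots> < 2 powr real l" using log0 by (intro powr_less_mono) (auto simp: l_def, linarith)
      also have "\<dots> = real (2 ^ l)" by (simp add: powr_realpow)
      finally show ?thesis by (simp only: of_nat_less_iff)
    qed
    moreover have "4 * real l \<le> T"
    proof -
      have "real l \<le> log 2 (real n) + 1" using log0 by (simp add: l_def)
      then show ?thesis using N[OF nN] by (simp add: T_def)
    qed
    moreover have "32 * real k ^ 4 * real (loss_const k) \<le> T" using N[OF nN] by (simp add: T_def K_def)
    moreover have "T ^ (6 + 2 * s) \<le> r"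
    proof -
      have "T ^ (6 + 2 * s) = real n powr (\<delta> * real (6 + 2 * s))"
        using npos by (simp add: T_def powr_powr flip: powr_realpow)
      also have "\<delta> * real (6 + 2 * s) = 1 / 4" by (simp add: \<delta>_def)
      finally show ?thesis by (simp add: r_def)
    qed
    moreover have "r ^ 5 \<le> real (\<Sum>L\<in>\<L>. card (L \<inter> P)) * T"
    proof -
      have "r ^ 5 = real n powr (5 / 4 - \<delta>) * T" by (simp add: rp T_def flip: powr_add)
      also have "\<dots> \<le> (c * real n powr (5 / 4 - \<delta>)) * T"
        using mult_right_mono[OF c1, of "real n powr (5 / 4 - \<delta>)"]
        by (intro mult_right_mono) (auto simp: T_def)
      also have "\<dots> \<le> real (card (incidences P \<L>)) * T" using many by (intro mult_right_mono) (auto simp: T_def)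
      finally show ?thesis by (simp only: card_incidences[OF fin])
    qed
    moreover have "r ^ 4 = real n" using npos by (simp add: rp)
    ultimately have "\<exists>x M w. induced_subdivision P \<L> k x M w"
      unfolding t(1) s_def using t(2) cP cL
      by (intro many_incidences_give_subdivision[where l = l and T = T and r = r]) (auto simp: l_def)
    then show False using no induced_subdivision_imp_contains_subdivided_clique[OF conf] by blast
  qed
  then show ?thesis using c1 \<delta> by (intro exI[of _ c] exI[of _ \<delta>]) auto
qed

end
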